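(* Let $f$ be an $\alpha$-Hölder continuous complex-valued function on the unit circle $\mathbb{T}$ with $\alpha>1/2$, such that $f$ is not the restriction to $\mathbb{T}$ of a function in $\mathcal{A}$. Let $m\in\mathbb{N}$. Then the following two conditions are equivalent: (i) $\mathrm{w}_{\mathbb{T}}(f+h)\geq -m$ for every $h\in\mathcal{A}$ such that $f+h\neq0$ on $\mathbb{T}$; (ii) $\mathrm{z}(f_n+p)\leq m+n$ for every $n\in\mathbb{Z}_+$ and every polynomial $p\in\mathcal{P}_n$, where $f_n(z)=z^n f_-(1/z)$, $z\in\mathbb{D}$.
   Context: $\mathbb{D}$ is the open unit disk in $\mathbb{C}$, $\mathbb{T}$ is the unit circle, $\mathbb{N}=\{1,2,\ldots\}$, $\mathbb{Z}_+=\mathbb{N}\cup\{0\}$. $\mathcal{A}$ is the disk algebra: functions continuous on $\overline{\mathbb{D}}$ and holomorphic in $\mathbb{D}$. $\mathcal{P}_n$ is the set of complex polynomials of degree at most $n$. For a non-vanishing continuous function $g$ on $\mathbb{T}$, $\mathrm{w}_{\mathbb{T}}(g)$ is the winding number of $g(\mathbb{T})$ around the origin, i.e., $2\pi\,\mathrm{w}_{\mathbb{T}}(g)$ is the change of the argument of $g$ when $\mathbb{T}$ is traversed once counterclockwise. For a function $g$ holomorphic in $\mathbb{D}$, $\mathrm{z}(g)$ is the number of zeros of $g$ in $\mathbb{D}$ counting multiplicities. The anti-analytic part of $f$ is $$f_-(z):=\frac{1}{2\pi i}\int_{\mathbb{T}}\frac{f(t)\,dt}{z-t},\qquad z\notin\overline{\mathbb{D}},$$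 which is holomorphic in $\{|z|>1\}$ and vanishes at infinity; thus $f_-(1/z)$ is holomorphic in $\mathbb{D}$, with value $0$ at $z=0$. *)

theory Defs
  imports
    "HOL-Complex_Analysis.Complex_Analysis"
    "HOL-Computational_Algebra.Polynomial"
    "HOL-Library.Extended_Nat"
begin

abbreviation unit_disk :: "complex set" where
  "unit_disk \<equiv> ball 0 1"

abbreviation unit_circle :: "complex set" where
  "unit_circle \<equiv> sphere 0 1"

definition holder_on ::
    "real \<Rightarrow> 'a set \<Rightarrow> ('a::metric_space \<Rightarrow> 'b::metric_space) \<Rightarrow> bool" where
  "holder_on \<alpha> S f \<longleftrightarrow>
     (\<exists>C. \<forall>x\<in>S. \<forall>y\<in>S. dist (f x) (f y) \<le> C * dist x y powr \<alpha>)"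

text \<open>Elements are total functions; only their values on the closed disk matter.\<close>

definition disk_algebra :: "(complex \<Rightarrow> complex) set" where
  "disk_algebra = {g. continuous_on (closure unit_disk) g \<and> g holomorphic_on unit_disk}"

text \<open>
  The library's winding number is complex-valued. For \<open>g\<close> continuous and without zeros on the
  circle, the curve \<open>g \<circ> circlepath 0 1\<close> is a closed path avoiding the origin and the value is
  an integer, so taking the real part loses nothing (lemma below).
\<close>

definition circle_winding :: "(complex \<Rightarrow> complex) \<Rightarrow> real" where
  "circle_winding g = Re (winding_number (g \<circ> circlepath 0 1) 0)"

lemma of_real_circle_winding:
  assumes "continuous_on unit_circle g" and "\<And>t. t \<in> unit_circle \<Longrightarrow> g t \<noteq> 0"
  shows "of_real (circle_winding g) = winding_number (g \<circ> circlepath 0 1) 0"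
    and "circle_winding g \<in> \<int>"
proof -
  have im: "path_image (circlepath 0 1) = unit_circle"
    by simp
  have "path (g \<circ> circlepath 0 1)"
    using assms(1) by (intro path_continuous_image) (simp_all add: im)
  moreover have "0 \<notin> path_image (g \<circ> circlepath 0 1)"
    using assms(2) im unfolding path_image_compose by force
  moreover have "pathfinish (g \<circ> circlepath 0 1) = pathstart (g \<circ> circlepath 0 1)"
    by (simp add: pathfinish_compose pathstart_compose)
  ultimately have "winding_number (g \<circ> circlepath 0 1) 0 \<in> \<int>"
    by (intro integer_winding_number) auto
  then obtain k where "winding_number (g \<circ> circlepath 0 1) 0 = of_int k"
    by (auto elim: Ints_cases)
  then show "of_real (circle_winding g) = winding_number (g \<circ> circlepath 0 1) 0"
    and "circle_winding g \<in> \<int>"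
    by (simp_all add: circle_winding_def)
qed

text \<open>
  Zeros in the open disk with multiplicity, for \<open>g\<close> holomorphic there. The value is \<open>\<infinity>\<close> if there
  are infinitely many zeros (in particular if \<open>g\<close> vanishes identically). Otherwise every
  zero is isolated and its \<open>zorder\<close> is its multiplicity, a positive integer.
\<close>

definition disk_zeros :: "(complex \<Rightarrow> complex) \<Rightarrow> enat" where
  "disk_zeros g =
     (let Z = {z \<in> unit_disk. g z = 0}
      in if finite Z then enat (\<Sum>z\<in>Z. nat (zorder g z)) else \<infinity>)"

text \<open>The anti-analytic part of \<open>f\<close>; meaningful for \<open>norm z > 1\<close> only.\<close>

definition anti_analytic_part :: "(complex \<Rightarrow> complex) \<Rightarrow> complex \<Rightarrow> complex" where
  "anti_analytic_part f z =
     1 / (2 * of_real pi * \<i>) * contour_integral (circlepath 0 1) (\<lambda>t. f t / (z - t))"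

text \<open>
  The function \<open>z^n * f_-(1/z)\<close> on the disk. As \<open>f_-\<close> vanishes at infinity, \<open>f_-(1/z)\<close> is
  extended by \<open>0\<close> to \<open>z = 0\<close>; this is done explicitly because \<open>1 / 0 = 0\<close> in HOL.
\<close>

definition reflected_part :: "(complex \<Rightarrow> complex) \<Rightarrow> nat \<Rightarrow> complex \<Rightarrow> complex" where
  "reflected_part f n z = z ^ n * (if z = 0 then 0 else anti_analytic_part f (1 / z))"

end

theory Submission
  imports Defs
begin

text \<open>
  For Hoelder data the Cauchy integrals inside and outside the circle extend continuously to it
  (Privalov) and \<open>f t = \<Psi> t + \<Phi> (cnj t)\<close> on the circle (Plemelj), where \<open>\<Psi>\<close> and \<open>\<Phi>\<close> lie in
  the disk algebra and \<open>\<Phi> z = f_-(1/z)\<close>. So \<open>\<Psi>\<close> can be absorbed into \<open>h\<close>. If \<open>h\<close> becomes a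
  polynomial \<open>q\<close> of degree at most \<open>n\<close>, then \<open>\<Phi> (cnj t) + q t = t^n * g (cnj t)\<close> with
  \<open>g z = z^n * \<Phi> z + p z\<close> and \<open>p\<close> the reversal of \<open>q\<close>. By the argument principle the winding number
  of the left-hand side is \<open>n\<close> minus the number of zeros of \<open>g\<close> in the disk.

  From zeros to winding numbers, approximate \<open>h\<close> uniformly by polynomials. Conversely \<open>g\<close> may vanish
  on the circle, and this is where \<open>\<alpha> > 1/2\<close> enters: \<open>\<Phi>\<close>, hence \<open>g\<close>, is Hoelder of an exponent above
  \<open>1/2\<close> there, so \<open>g\<close> maps the circle to a null set and an arbitrarily small constant added to \<open>g\<close>
  removes the zeros on the circle without losing those inside.
\<close>

section \<open>Winding numbers along the circle\<close>

text \<open>Conjugation runs through the circle backwards and so changes the sign of the winding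
  number, while the factor \<open>t ^ n\<close> adds \<open>n\<close>. Since \<open>G\<close> is
  merely continuous, both effects are read off a continuous logarithm along the path.\<close>

lemma circle_winding_shift_reflect:
  assumes "continuous_on unit_circle G" "\<And>t. t \<in> unit_circle \<Longrightarrow> G t \<noteq> 0"
  shows "circle_winding (\<lambda>t. t ^ n * G (cnj t)) = real n - circle_winding G"
proof -
  define c where "c = circlepath 0 1"
  have c: "c x = exp (2 * of_real pi * \<i> * of_real x)" for x
    by (simp add: c_def circlepath)
  have "path (G \<circ> c)" "0 \<notin> path_image (G \<circ> c)"
    using assms unfolding c_def
    by (auto intro!: path_continuous_image simp: path_image_compose)
  then obtain q where q: "path q"
      "pathfinish q - pathstart q = 2 * of_real pi * \<i> * winding_number (G \<circ> c) 0"
      "\<And>x. x \<in> {0..1} \<Longrightarrow> (G \<circ> c) x = exp (q x)"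
    using winding_number_as_continuous_log[of "G \<circ> c" 0] by (metis add_0)
  \<comment> \<open>A continuous logarithm of the new curve: that of \<open>t ^ n\<close> plus
    \<open>q\<close> run backwards.\<close>
  define q' where "q' = (\<lambda>x. of_nat n * (2 * of_real pi * \<i> * of_real x) + q (1 - x))"
  have "path (reversepath q)" using q(1) by simp
  then have q': "path q'"
    unfolding q'_def path_def reversepath_def by (auto intro!: continuous_intros)
  have cc: "cnj (c x) = c (1 - x)" for x
    by (simp add: c exp_cnj right_diff_distrib exp_diff exp_minus divide_inverse)
  have "winding_number ((\<lambda>t. t ^ n * G (cnj t)) \<circ> c) 0 = winding_number (exp \<circ> q') 0"
  proof (rule winding_number_cong)
    fix x :: real assume x: "0 \<le> x" "x \<le> 1"
    have "G (c (1 - x)) = exp (q (1 - x))" using q(3)[of "1 - x"] x by simp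
    then show "((\<lambda>t. t ^ n * G (cnj t)) \<circ> c) x = (exp \<circ> q') x"
      by (simp add: q'_def exp_add cc exp_of_nat_mult) (simp add: c)
  qed
  also have "\<dots> = (pathfinish q' - pathstart q') / (2 * of_real pi * \<i>)"
    by (rule winding_number_compose_exp[OF q'])
  also have "pathfinish q' - pathstart q' =
      of_nat n * (2 * of_real pi * \<i>) - (pathfinish q - pathstart q)"
    by (simp add: q'_def pathfinish_def pathstart_def)
  also have "\<dots> / (2 * of_real pi * \<i>) = of_nat n - winding_number (G \<circ> c) 0"
    by (simp add: q(2) field_simps)
  finally show ?thesis
    unfolding circle_winding_def c_def[symmetric] by (simp only: minus_complex.sel complex_Re_of_nat)
qed

lemma circle_winding_cong:
  assumes "\<And>t. t \<in> unit_circle \<Longrightarrow> g t = h t"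
  shows "circle_winding g = circle_winding h"
proof -
  have "winding_number (g \<circ> circlepath 0 1) 0 = winding_number (h \<circ> circlepath 0 1) 0"
    by (rule winding_number_cong) (simp add: assms circlepath)
  then show ?thesis by (simp add: circle_winding_def)
qed

text \<open>Rouche's theorem in its topological form. It serves to move the circle inwards, to
  replace \<open>h\<close> by a polynomial and to add a small constant.\<close>

lemma circle_winding_nearby:
  assumes "continuous_on unit_circle g" "continuous_on unit_circle h"
    and "\<And>t. t \<in> unit_circle \<Longrightarrow> norm (h t - g t) < norm (g t)"
  shows "circle_winding h = circle_winding g"
proof -
  have "winding_number (h \<circ> circlepath 0 1) 0 = winding_number (g \<circ> circlepath 0 1) 0"
    by (rule winding_number_nearby_loops_eq)
      (use assms in \<open>auto intro!: path_continuous_image simp: pathfinish_compose pathstart_compose\<close>,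
       simp add: circlepath)
  then show ?thesis by (simp add: circle_winding_def)
qed

section \<open>The argument principle on circles\<close>

lemma finite_zeros_ball:
  fixes f :: "complex \<Rightarrow> complex"
  assumes "f holomorphic_on ball 0 R" "r < R" "z0 \<in> ball 0 R" "f z0 \<noteq> 0"
  shows "finite {z \<in> cball 0 r. f z = 0}"
proof (cases "f constant_on ball 0 R")
  case True
  then have "f z \<noteq> 0" if "z \<in> cball 0 r" for z
    using assms that unfolding constant_on_def by force
  then have "{z \<in> cball 0 r. f z = 0} = {}" by blast
  then show ?thesis by (simp only: finite.emptyI)
next
  case False
  then show ?thesis
    using holomorphic_compact_finite_zeros[OF assms(1), of "cball 0 r"] assms(2) by force
qed

lemma zorder_zero_pos:
  fixes f :: "complex \<Rightarrow> complex"
  assumes "f holomorphic_on ball 0 R" "z0 \<in> ball 0 R" "f z0 \<noteq> 0" "z \<in> ball 0 R" "f z = 0"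
  shows "zorder f z > 0"
  using zorder_exist_zero[OF assms(1) open_ball connected_ball assms(4)] assms(2,3,5) by force

text \<open>The argument principle counts zeros by integrating \<open>deriv f / f\<close>. The
  substitution \<open>w = f z\<close> turns this into the integral of \<open>1 / w\<close> over the
  image curve, which is the winding number up to the factor \<open>2 * pi * \<i>\<close>.\<close>

lemma circle_winding_eq_sum_zorder:
  assumes f: "f holomorphic_on ball 0 R" and r: "0 < r" "r < R"
    and nz: "\<And>z. norm z = r \<Longrightarrow> f z \<noteq> 0"
  shows "circle_winding (\<lambda>t. f (of_real r * t)) = of_int (\<Sum>z | z \<in> ball 0 r \<and> f z = 0. zorder f z)"
proof -
  define g where "g = circlepath 0 r"
  have nz0: "f (of_real r) \<noteq> 0" "complex_of_real r \<in> ball 0 R"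
    using nz[of "of_real r"] r by auto
  \<comment> \<open>On \<open>ball 0 R\<close> itself the zeros of \<open>f\<close> may accumulate
    at the boundary. In a slightly smaller ball that still contains the circle there are only
    finitely many, as \<open>argument_principle\<close> requires.\<close>
  define R' where "R' = (r + R) / 2"
  have R': "r < R'" "R' < R" using r by (auto simp: R'_def)
  have gim: "path_image g = sphere 0 r" using r by (simp add: g_def)
  define pz where "pz = {w \<in> ball 0 R'. f w = 0}"
  have fin: "finite pz"
    using finite_zeros_ball[OF f R'(2) nz0(2,1)]
    unfolding pz_def by (rule rev_finite_subset) auto
  have f': "f holomorphic_on ball 0 R'" using f R' by (rule_tac holomorphic_on_subset) auto
  have w1: "winding_number g p = 1" if "p \<in> ball 0 r" for p
    unfolding g_def using winding_number_circlepath[of p 0 r] that by simp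
  have w0: "winding_number g p = 0" if "p \<notin> cball 0 r" for p
    unfolding g_def using that r
    by (intro winding_number_zero_outside[of _ "cball 0 r"]) auto
  have "contour_integral g (\<lambda>x. deriv f x * 1 / f x) =
      2 * pi * \<i> * (\<Sum>p\<in>pz. winding_number g p * 1 * zorder f p)"
  proof -
    have pz: "pz = {w \<in> ball 0 R'. f w = 0 \<or> w \<in> {}}" by (simp add: pz_def)
    show ?thesis
      unfolding pz
    proof (rule argument_principle)
      show "path_image g \<subseteq> ball 0 R' - {w \<in> ball 0 R'. f w = 0 \<or> w \<in> {}}"
        unfolding gim using nz R' by auto
      show "\<forall>z. z \<notin> ball 0 R' \<longrightarrow> winding_number g z = 0"
        using w0 R' by auto
      show "finite {w \<in> ball 0 R'. f w = 0 \<or> w \<in> {}}" using fin pz by simp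
    qed (use f' in \<open>auto simp: g_def\<close>)
  qed
  \<comment> \<open>Zeros beyond the circle have winding number 0 and drop out; those inside have
    winding number 1.\<close>
  also have "(\<Sum>p\<in>pz. winding_number g p * 1 * zorder f p) = (\<Sum>p | p \<in> ball 0 r \<and> f p = 0. of_int (zorder f p))"
  proof (rule sum.mono_neutral_cong_right[OF fin])
    show "{p. p \<in> ball 0 r \<and> f p = 0} \<subseteq> pz" using R' by (auto simp: pz_def)
    show "\<forall>i\<in>pz - {p. p \<in> ball 0 r \<and> f p = 0}. winding_number g i * 1 * of_int (zorder f i) = 0"
    proof
      fix i assume i: "i \<in> pz - {p. p \<in> ball 0 r \<and> f p = 0}"
      then have "norm i \<noteq> r" "\<not> norm i < r" using nz by (auto simp: pz_def)
      then show "winding_number g i * 1 * of_int (zorder f i) = 0" using w0[of i] by simp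
    qed
  qed (use w1 in auto)
  finally have *: "contour_integral g (\<lambda>x. deriv f x * 1 / f x) =
      2 * pi * \<i> * of_int (\<Sum>p | p \<in> ball 0 r \<and> f p = 0. zorder f p)" by simp
  have vp: "valid_path (f \<circ> g)"
    using f' gim R' by (intro valid_path_compose_holomorphic[of _ _ "ball 0 R'"]) (auto simp: g_def)
  have "0 \<notin> path_image (f \<circ> g)" unfolding path_image_compose gim using nz by force
  then have "winding_number (f \<circ> g) 0 = 1 / (2 * pi * \<i>) * contour_integral (f \<circ> g) (\<lambda>w. 1 / (w - 0))"
    using winding_number_valid_path[OF vp] by simp
  also have "contour_integral (f \<circ> g) (\<lambda>w. 1 / (w - 0)) = contour_integral g (\<lambda>x. deriv f x * 1 / f x)"
    unfolding contour_integral_integral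
  proof (rule integral_cong)
    fix x :: real assume "x \<in> {0..1}"
    then have "g x \<in> sphere 0 r" unfolding gim[symmetric] path_image_def by blast
    then have gx: "g x \<in> ball 0 R'" using R' by auto
    have "vector_derivative (f \<circ> g) (at x) = vector_derivative g (at x) * deriv f (g x)"
    proof (rule vector_derivative_chain_at_general)
      show "g differentiable at x"
        unfolding g_def by (rule differentiableI_vector[OF has_vector_derivative_circlepath])
      show "f field_differentiable at (g x)"
        using f' gx holomorphic_on_imp_differentiable_at by blast
    qed
    then show "1 / ((f \<circ> g) x - 0) * vector_derivative (f \<circ> g) (at x) =
        deriv f (g x) * 1 / f (g x) * vector_derivative g (at x)"
      by simp
  qed
  also have "1 / (2 * pi * \<i>) * \<dots> = of_int (\<Sum>p | p \<in> ball 0 r \<and> f p = 0. zorder f p)"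
    unfolding * by simp
  finally have "winding_number (f \<circ> g) 0 = of_int (\<Sum>p | p \<in> ball 0 r \<and> f p = 0. zorder f p)" .
  moreover have "f \<circ> g = (\<lambda>t. f (of_real r * t)) \<circ> circlepath 0 1"
    by (simp add: fun_eq_iff g_def circlepath)
  ultimately show ?thesis unfolding circle_winding_def by simp
qed

lemma norm_bounded_away_from_0:
  fixes f :: "'a::topological_space \<Rightarrow> 'b::real_normed_vector"
  assumes "compact S" "continuous_on S f" "\<And>x. x \<in> S \<Longrightarrow> f x \<noteq> 0"
  obtains e where "e > 0" "\<And>x. x \<in> S \<Longrightarrow> e \<le> norm (f x)"
proof (cases "S = {}")
  case True
  then show ?thesis using that[of 1] by simp
next
  case False
  have "continuous_on S (\<lambda>x. norm (f x))" using assms(2) by (intro continuous_intros)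
  then obtain x0 where "x0 \<in> S" "\<And>x. x \<in> S \<Longrightarrow> norm (f x0) \<le> norm (f x)"
    using continuous_attains_inf[OF assms(1) False] by blast
  then show ?thesis using that[of "norm (f x0)"] assms(3) by simp
qed

text \<open>\<open>G\<close> may fail to be holomorphic on the unit circle, so the argument
  principle cannot be applied there directly. By uniform continuity there are no zeros near the
  circle, and a slightly smaller circle has the same winding number and encloses the same
  zeros.\<close>

lemma circle_winding_disk_algebra:
  assumes cont: "continuous_on (cball 0 1) G" and holo: "G holomorphic_on unit_disk"
    and nz: "\<And>t. t \<in> unit_circle \<Longrightarrow> G t \<noteq> 0"
  shows "finite {z \<in> unit_disk. G z = 0}"
    and "circle_winding G = of_int (\<Sum>z | z \<in> unit_disk \<and> G z = 0. zorder G z)"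
proof -
  have uc: "uniformly_continuous_on (cball 0 1) G"
    using cont by (simp add: compact_uniformly_continuous)
  have "continuous_on unit_circle G" using cont by (rule continuous_on_subset) auto
  from norm_bounded_away_from_0[OF compact_sphere this nz]
  obtain e where e: "e > 0" "\<And>t. t \<in> unit_circle \<Longrightarrow> e \<le> norm (G t)" by blast
  then obtain d where d: "d > 0"
      "\<And>x y. \<lbrakk>x \<in> cball 0 1; y \<in> cball 0 1; dist x y < d\<rbrakk> \<Longrightarrow> dist (G x) (G y) < e"
    using uc unfolding uniformly_continuous_on_def by metis
  \<comment> \<open>\<open>1 - r < d\<close> keeps radial displacements within the modulus of
    continuity; the maximum with \<open>1/2\<close> keeps the radius positive.\<close>
  define r where "r = max (1/2) (1 - d/2)"
  have r: "0 < r" "r < 1" "1 - r < d" using d(1) by (auto simp: r_def max_def)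
  \<comment> \<open>This has two uses: for all \<open>s\<close> between \<open>r\<close> and 1 it
    excludes zeros in the closed annulus, and at \<open>s = r\<close> it compares the two winding
    numbers.\<close>
  have near: "norm (G (of_real s * t) - G t) < norm (G t)" if "r \<le> s" "s \<le> 1" "t \<in> unit_circle" for s t
  proof -
    have "dist (of_real s * t) t = norm (of_real (s - 1) * t)"
      by (simp add: dist_norm algebra_simps)
    also have "\<dots> = 1 - s" using that by (simp add: norm_mult del: of_real_diff)
    finally have "dist (of_real s * t) t < d" using that r by simp
    moreover have "norm (of_real s * t) \<le> 1" using that r by (simp add: norm_mult)
    ultimately have "dist (G (of_real s * t)) (G t) < e"
      using that by (intro d(2)) auto
    then show ?thesis using e(2)[OF that(3)] by (simp add: dist_norm)
  qed
  have nzr: "G z \<noteq> 0" if "r \<le> norm z" "norm z \<le> 1" for z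
  proof -
    have z: "z \<noteq> 0" using that r by auto
    then have "z = of_real (norm z) * (z / of_real (norm z))" by simp
    then show ?thesis
      using near[OF that, of "z / of_real (norm z)"] z by (auto simp: norm_divide)
  qed
  have eq: "{z \<in> unit_disk. G z = 0} = {z. z \<in> ball 0 r \<and> G z = 0}"
    using nzr r by force
  have "finite {z \<in> cball 0 r. G z = 0}"
    using finite_zeros_ball[OF holo r(2), of "of_real r"] nzr[of "of_real r"] r by simp
  then show "finite {z \<in> unit_disk. G z = 0}"
    unfolding eq by (rule rev_finite_subset) auto
  have "circle_winding (\<lambda>t. G (of_real r * t)) = circle_winding G"
  proof (rule circle_winding_nearby)
    show "continuous_on unit_circle G" using cont by (rule continuous_on_subset) auto
    show "continuous_on unit_circle (\<lambda>t. G (of_real r * t))"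
      using r by (intro continuous_on_compose2[OF cont] continuous_intros) (auto simp: norm_mult)
  qed (use near r in auto)
  with circle_winding_eq_sum_zorder[OF holo r(1,2)] nzr r eq
  show "circle_winding G = of_int (\<Sum>z | z \<in> unit_disk \<and> G z = 0. zorder G z)"
    by auto
qed

section \<open>Hoelder functions on the circle\<close>

lemma dist_circlepath_le: "dist (circlepath 0 1 x) (circlepath 0 1 y) \<le> 2 * pi * \<bar>x - y\<bar>"
proof -
  have "norm (circlepath 0 1 x - circlepath 0 1 y) \<le> (2 * pi) * norm (x - y)"
  proof (rule differentiable_bound[where S = UNIV])
    show "(circlepath 0 1 has_derivative (\<lambda>h. h *\<^sub>R (2 * pi * \<i> * 1 * exp (2 * of_real pi * \<i> * x)))) (at x within UNIV)" for x
      using has_vector_derivative_circlepath[of 0 1 x UNIV] unfolding has_vector_derivative_def by simp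
    show "onorm (\<lambda>h. h *\<^sub>R (2 * pi * \<i> * 1 * exp (2 * of_real pi * \<i> * complex_of_real x))) \<le> 2 * pi" for x :: real
      by (rule onorm_le) (simp add: norm_mult)
  qed auto
  then show ?thesis by (simp add: dist_norm)
qed

text \<open>Cutting the circle into \<open>n\<close> equal arcs puts the image into \<open>n\<close>
  disks of radius of order \<open>n powr (- \<beta>)\<close>. Their total area is of order
  \<open>n powr (1 - 2 * \<beta>)\<close>, which tends to 0 because \<beta> > 1/2.\<close>

lemma negligible_image_circle_holder:
  fixes g :: "complex \<Rightarrow> complex"
  assumes \<beta>: "\<beta> > 1/2" and hol: "holder_on \<beta> unit_circle g"
  shows "negligible (g ` unit_circle)"
proof -
  obtain C0 where C0: "\<And>x y. x \<in> unit_circle \<Longrightarrow> y \<in> unit_circle \<Longrightarrow> dist (g x) (g y) \<le> C0 * dist x y powr \<beta>"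
    using hol unfolding holder_on_def by blast
  \<comment> \<open>\<open>holder_on\<close> does not fix the sign of its constant, but the radius
    \<open>\<rho>\<close> below must be nonnegative.\<close>
  define C where "C = max C0 0"
  have C: "dist (g x) (g y) \<le> C * dist x y powr \<beta>" if "x \<in> unit_circle" "y \<in> unit_circle" for x y
    using C0[OF that] by (rule order_trans) (auto simp: C_def intro: mult_right_mono)
  have C_nonneg: "C \<ge> 0" by (simp add: C_def)
  define K where "K = unit_ball_vol 2 * (C * (2 * pi) powr \<beta>)\<^sup>2"
  have "\<exists>T. g ` unit_circle \<subseteq> T \<and> T \<in> lmeasurable \<and> measure lebesgue T \<le> K * real (Suc N) powr (1 - 2 * \<beta>)" for N
  proof (intro exI conjI)
    define n where "n = Suc N"
    define \<rho> where "\<rho> = C * (2 * pi / n) powr \<beta>"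
    have \<rho>: "\<rho> \<ge> 0" using C_nonneg by (simp add: \<rho>_def)
    show "g ` unit_circle \<subseteq> \<Union>((\<lambda>j. cball (g (circlepath 0 1 (j / n))) \<rho>) ` {..<n})"
    proof clarify
      fix t :: complex assume t: "t \<in> unit_circle"
      then have "t \<in> path_image (circlepath 0 1)" by simp
      \<comment> \<open>The parameter 1 is traded for 0, the same point of the circle, so that the
        arc index \<open>j\<close> stays below \<open>n\<close>.\<close>
      then obtain x where x: "0 \<le> x" "x < 1" "t = circlepath 0 1 x"
      proof -
        obtain x where x: "0 \<le> x" "x \<le> 1" "t = circlepath 0 1 x"
          using \<open>t \<in> path_image (circlepath 0 1)\<close> unfolding path_image_def by auto
        show thesis
        proof (cases "x = 1")
          case True
          then have "t = circlepath 0 1 0" using x(3) by (simp add: circlepath)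
          then show ?thesis using that[of 0] by simp
        qed (use x that in auto)
      qed
      define j where "j = nat \<lfloor>x * n\<rfloor>"
      have n: "real n > 0" by (simp add: n_def)
      have j1: "real j \<le> x * n" "x * n < real j + 1"
        using x by (simp_all add: j_def of_nat_nat)
      have "x * n < n" using x n by simp
      then have j: "j < n" using j1 by linarith
      have "j / n - x = (j - x * n) / n" using n by (simp add: field_simps)
      then have "\<bar>j / n - x\<bar> = \<bar>j - x * n\<bar> / n" by simp
      also have "\<dots> \<le> 1 / n" using j1 by (intro divide_right_mono) auto
      finally have "\<bar>j / n - x\<bar> \<le> 1 / n" .
      then have "2 * pi * \<bar>j / n - x\<bar> \<le> 2 * pi / n"
        using mult_left_mono[of "\<bar>j / n - x\<bar>" "1 / n" "2 * pi"] by simp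
      then have "dist (circlepath 0 1 (j / n)) t \<le> 2 * pi / n"
        using dist_circlepath_le[of "j / n" x] unfolding x(3) by linarith
      moreover have "circlepath 0 1 (j / n) \<in> unit_circle" by (simp add: circlepath)
      ultimately have "dist (g (circlepath 0 1 (j / n))) (g t) \<le> \<rho>"
        using t \<beta> C_nonneg C[of "circlepath 0 1 (j / n)" t] unfolding \<rho>_def
        by (meson order_trans mult_left_mono powr_mono2 zero_le_dist less_imp_le zero_less_divide_1_iff zero_less_numeral less_trans)
      then show "g t \<in> \<Union>((\<lambda>j. cball (g (circlepath 0 1 (j / n))) \<rho>) ` {..<n})"
        using j by auto
    qed
    show "\<Union>((\<lambda>j. cball (g (circlepath 0 1 (j / n))) \<rho>) ` {..<n}) \<in> lmeasurable"
      by (intro fmeasurable.finite_Union) auto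
    have "measure lebesgue (\<Union>((\<lambda>j. cball (g (circlepath 0 1 (j / n))) \<rho>) ` {..<n}))
        \<le> (\<Sum>j<n. measure lebesgue (cball (g (circlepath 0 1 (j / n))) \<rho>))"
      by (rule measure_UNION_le) auto
    also have "\<dots> = (\<Sum>j<n. unit_ball_vol 2 * \<rho>\<^sup>2)"
      using content_ball[where ?'a = complex, OF \<rho>] by (intro sum.cong) (auto simp: content_cball_conv_ball)
    also have "\<dots> = n * unit_ball_vol 2 * \<rho>\<^sup>2" by simp
    also have "\<rho>\<^sup>2 = (C * (2 * pi) powr \<beta>)\<^sup>2 * real n powr (- 2 * \<beta>)"
    proof -
      have "(2 * pi / n) powr \<beta> = (2 * pi) powr \<beta> * real n powr (- \<beta>)"
        by (simp add: powr_divide powr_minus_divide)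
      moreover have "(real n powr (- \<beta>))\<^sup>2 = real n powr (- 2 * \<beta>)"
        by (simp add: power2_eq_square powr_add[symmetric])
      ultimately show ?thesis by (simp add: \<rho>_def power_mult_distrib mult.assoc)
    qed
    also have "n * unit_ball_vol 2 * ((C * (2 * pi) powr \<beta>)\<^sup>2 * real n powr (- 2 * \<beta>)) = K * (real n powr 1 * real n powr (- 2 * \<beta>))"
      by (simp add: K_def)
    also have "\<dots> = K * real n powr (1 + - 2 * \<beta>)" by (simp only: powr_add)
    also have "\<dots> = K * real (Suc N) powr (1 - 2 * \<beta>)" by (simp add: n_def)
    finally show "measure lebesgue (\<Union>((\<lambda>j. cball (g (circlepath 0 1 (j / n))) \<rho>) ` {..<n})) \<le> \<dots>" .
  qed
  then obtain T where T: "\<And>N. g ` unit_circle \<subseteq> T N" "\<And>N. T N \<in> lmeasurable"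
      "\<And>N. measure lebesgue (T N) \<le> K * real (Suc N) powr (1 - 2 * \<beta>)" by metis
  have "(\<lambda>N. K * real (Suc N) powr (1 - 2 * \<beta>)) \<longlonglongrightarrow> K * 0"
    using \<beta> by (intro tendsto_intros tendsto_neg_powr filterlim_compose[OF filterlim_real_sequentially filterlim_Suc]) auto
  then have lim: "(\<lambda>N. K * real (Suc N) powr (1 - 2 * \<beta>)) \<longlonglongrightarrow> 0" by simp
  show ?thesis
  proof (rule iffD2[OF negligible_outer], intro allI impI)
    fix e :: real assume "e > 0"
    then obtain N where "K * real (Suc N) powr (1 - 2 * \<beta>) < e"
      by (blast dest: order_tendstoD(2)[OF lim] eventually_happens'[OF sequentially_bot])
    then show "\<exists>S. g ` unit_circle \<subseteq> S \<and> S \<in> lmeasurable \<and> measure lebesgue S < e"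
      using T(1)[of N] T(2)[of N] T(3)[of N] by (meson le_less_trans)
  qed
qed

section \<open>Cauchy integrals of Hoelder functions\<close>

text \<open>Jordan's inequality with the constant 1 instead of the sharp 2. Up to \<open>1/3\<close>
  it follows from the mean value theorem with \<open>cos z \<ge> 1/2\<close>, and beyond that from
  \<open>sin (pi / 6) = 1/2\<close> and monotonicity.\<close>

lemma sin_pi_mult_ge:
  fixes x :: real
  assumes "0 \<le> x" "x \<le> 1/2"
  shows "x \<le> sin (pi * x)"
proof (cases "x \<le> 1/3")
  case True
  show ?thesis
  proof (cases "x = 0")
    case False
    then have "0 < pi * x" using assms by simp
    from MVT2[OF this, of sin cos] obtain z where z: "0 < z" "z < pi * x" "sin (pi * x) = pi * x * cos z"
      by (auto intro: derivative_eq_intros)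
    have "pi * x \<le> pi / 3" using True by simp
    then have "z \<le> pi / 3" using z by linarith
    then have "cos (pi / 3) \<le> cos z" using z by (intro cos_monotone_0_pi_le) auto
    then have "1 / 2 \<le> cos z" by (simp add: cos_60)
    then have "pi * x * (1/2) \<le> sin (pi * x)"
      unfolding z(3) using assms by (intro mult_left_mono) auto
    moreover have "2 * x \<le> pi * x" using pi_ge_two assms by (intro mult_right_mono) auto
    ultimately show ?thesis by simp
  qed simp
next
  case False
  have "pi * x \<le> pi * (1/2)" "pi * (1/6) \<le> pi * x"
    using assms False by (intro mult_left_mono; simp)+
  then have "sin (pi / 6) \<le> sin (pi * x)"
    by (intro sin_monotone_2pi_le) auto
  then show ?thesis using assms by (simp add: sin_30)
qed

text \<open>A chord is compared with its arc: the chord is twice the modulus of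
  \<open>sin (pi * x)\<close>, and the minimum stands for the shorter of the two arcs to 1.\<close>

lemma norm_circlepath_minus_1:
  assumes "0 \<le> x" "x \<le> 1"
  shows "2 * min x (1 - x) \<le> norm (circlepath 0 1 x - 1)"
proof -
  have "norm (circlepath 0 1 x - 1) = 2 * \<bar>sin (2 * pi * x / 2)\<bar>"
    using dist_exp_i_1[of "2 * pi * x"] by (simp add: circlepath mult_ac)
  then have *: "norm (circlepath 0 1 x - 1) = 2 * \<bar>sin (pi * x)\<bar>" by simp
  show ?thesis
  proof (cases "x \<le> 1/2")
    case True
    then show ?thesis using sin_pi_mult_ge[of x] assms * by simp
  next
    case False
    have "sin (pi * (1 - x)) = sin (pi * x)" by (simp add: right_diff_distrib sin_diff)
    then show ?thesis using sin_pi_mult_ge[of "1 - x"] assms False * by simp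
  qed
qed

text \<open>Moves a boundary point \<open>\<zeta>\<close> to 1, where the kernel is estimated. The
  rotated circle is the same closed path with another starting point.\<close>

lemma contour_integral_circle_rotate:
  assumes "norm \<zeta> = 1"
  shows "contour_integral (circlepath 0 1) g = contour_integral (circlepath 0 1) (\<lambda>u. g (\<zeta> * u) * \<zeta>)"
proof -
  have "\<zeta> \<in> path_image (circlepath 0 1)" using assms by simp
  then obtain a where a: "a \<in> {0..1}" "\<zeta> = circlepath 0 1 a"
    unfolding path_image_def by blast
  have sh: "shiftpath a (circlepath 0 1) = (\<lambda>x. \<zeta> * circlepath 0 1 x)"
    by (auto simp: shiftpath_def fun_eq_iff circlepath a(2) exp_add[symmetric] ring_distribs exp_diff)
  have "contour_integral (circlepath 0 1) g = contour_integral (\<lambda>x. \<zeta> * circlepath 0 1 x) g"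
    using contour_integral_shiftpath[of "circlepath 0 1" a g] a unfolding sh by simp
  also have "\<dots> = contour_integral (circlepath 0 1) (\<lambda>u. g (\<zeta> * u) * \<zeta>)"
    unfolding contour_integral_integral
  proof (rule integral_cong)
    fix x :: real
    have "((\<lambda>x. \<zeta> * circlepath 0 1 x) has_vector_derivative
        \<zeta> * (2 * pi * \<i> * 1 * exp (2 * of_real pi * \<i> * x))) (at x)"
      using has_vector_derivative_mult_right[OF has_vector_derivative_circlepath[of 0 1 x UNIV], of \<zeta>] by simp
    then show "g (\<zeta> * circlepath 0 1 x) * vector_derivative (\<lambda>x. \<zeta> * circlepath 0 1 x) (at x) =
        g (\<zeta> * circlepath 0 1 x) * \<zeta> * vector_derivative (circlepath 0 1) (at x)"
      by (simp add: vector_derivative_at vector_derivative_circlepath)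
  qed
  finally show ?thesis .
qed

text \<open>On the circle \<open>cnj t\<close> is \<open>1 / t\<close>, whose derivative is
  \<open>- (cnj t)\<^sup>2\<close>; the reversed orientation removes the sign. This is how the
  exterior Cauchy integral of \<open>f\<close> becomes an interior one of
  \<open>f \<circ> cnj\<close>.\<close>

lemma contour_integral_circle_cnj:
  "contour_integral (circlepath 0 1) g = contour_integral (circlepath 0 1) (\<lambda>t. g (cnj t) * (cnj t)\<^sup>2)"
proof -
  have cc: "circlepath 0 1 (1 - x) = cnj (circlepath 0 1 x)" for x
    by (simp add: circlepath exp_cnj right_diff_distrib exp_diff exp_minus divide_inverse)
  have r: "reversepath (circlepath 0 1) = (\<lambda>x. cnj (circlepath 0 1 x))"
    by (simp add: reversepath_def cc)
  have "contour_integral (circlepath 0 1) g = - contour_integral (\<lambda>x. cnj (circlepath 0 1 x)) g"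
    using contour_integral_reversepath[of "circlepath 0 1" g] unfolding r by simp
  also have "\<dots> = integral {0..1} (\<lambda>x. - (g (cnj (circlepath 0 1 x)) * vector_derivative (\<lambda>x. cnj (circlepath 0 1 x)) (at x)))"
    by (simp add: contour_integral_integral)
  also have "\<dots> = contour_integral (circlepath 0 1) (\<lambda>t. g (cnj t) * (cnj t)\<^sup>2)"
    unfolding contour_integral_integral
  proof (rule integral_cong)
    fix x :: real
    define e where "e = exp (2 * of_real pi * \<i> * complex_of_real x)"
    have "((\<lambda>x. cnj (circlepath 0 1 x)) has_vector_derivative
        cnj (2 * pi * \<i> * 1 * exp (2 * of_real pi * \<i> * x))) (at x)"
      using has_vector_derivative_cnj[OF has_vector_derivative_circlepath[of 0 1 x UNIV]] by simp
    then have v1: "vector_derivative (\<lambda>x. cnj (circlepath 0 1 x)) (at x) = - (2 * pi * \<i> * cnj e)"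
      by (simp add: vector_derivative_at e_def)
    have v2: "vector_derivative (circlepath 0 1) (at x) = 2 * pi * \<i> * e"
      by (simp add: vector_derivative_circlepath e_def)
    have c1: "circlepath 0 1 x = e" by (simp add: circlepath e_def)
    have "cnj e * e = 1"
      by (simp add: e_def exp_cnj exp_add[symmetric])
    then have sq: "(cnj e)\<^sup>2 * e = cnj e" by (simp add: power2_eq_square mult.assoc)
    have "- (g (cnj e) * - (2 * pi * \<i> * cnj e)) = g (cnj e) * (2 * pi * \<i>) * ((cnj e)\<^sup>2 * e)"
      unfolding sq by simp
    then show "- (g (cnj (circlepath 0 1 x)) * vector_derivative (\<lambda>x. cnj (circlepath 0 1 x)) (at x)) =
        g (cnj (circlepath 0 1 x)) * (cnj (circlepath 0 1 x))\<^sup>2 * vector_derivative (circlepath 0 1) (at x)"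
      unfolding v1 v2 c1 by (simp only: mult_ac)
  qed
  finally show ?thesis .
qed

section \<open>Size of kernel integrals with Hoelder densities\<close>

lemma holder_on_imp_continuous_on:
  assumes "\<alpha> > 0" "holder_on \<alpha> S f"
  shows "continuous_on S f"
proof -
  obtain C where C: "\<And>x y. x \<in> S \<Longrightarrow> y \<in> S \<Longrightarrow> dist (f x) (f y) \<le> C * dist x y powr \<alpha>"
    using assms unfolding holder_on_def by blast
  show ?thesis
    unfolding continuous_on_def
  proof
    fix x assume x: "x \<in> S"
    have "((\<lambda>y. dist y x powr \<alpha>) \<longlongrightarrow> 0 powr \<alpha>) (at x within S)"
      by (rule tendsto_powr2) (use assms in \<open>auto intro!: tendsto_eq_intros\<close>)
    from tendsto_mult_left[OF this, of C]
    have "((\<lambda>y. C * dist y x powr \<alpha>) \<longlongrightarrow> 0) (at x within S)" by simp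
    moreover have "\<forall>\<^sub>F y in at x within S. norm (dist (f y) (f x)) \<le> C * dist y x powr \<alpha>"
      unfolding eventually_at_filter real_norm_def abs_of_nonneg[OF zero_le_dist]
      by (intro always_eventually allI impI C x)
    ultimately have "((\<lambda>y. dist (f y) (f x)) \<longlongrightarrow> 0) (at x within S)"
      by (rule Lim_null_comparison[rotated])
    then show "(f \<longlongrightarrow> f x) (at x within S)" by (rule iffD2[OF tendsto_dist_iff])
  qed
qed

text \<open>The two summands belong to the two ends of the parameter interval, which are one point
  of the circle. \<open>B\<close> is an explicit antiderivative; the term with \<open>d + 1\<close>
  enters with a favourable sign and is dropped.\<close>

lemma integral_two_sided_powr_le:
  fixes d \<alpha> K :: real
  assumes d: "d > 0" and \<alpha>: "\<alpha> < 1" and K: "K \<ge> 0"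
  shows "integral {0..1} (\<lambda>x. K * ((d + x) powr (\<alpha> - 2) + (d + (1 - x)) powr (\<alpha> - 2)))
    \<le> 2 * K / (1 - \<alpha>) * d powr (\<alpha> - 1)"
proof -
  define b where "b = (\<lambda>x. K * ((d + x) powr (\<alpha> - 2) + (d + (1 - x)) powr (\<alpha> - 2)))"
  define B where "B = (\<lambda>x. K / (\<alpha> - 1) * ((d + x) powr (\<alpha> - 1) - (d + (1 - x)) powr (\<alpha> - 1)))"
  have "(b has_integral (B 1 - B 0)) {0..1}"
  proof (rule fundamental_theorem_of_calculus)
    fix x :: real assume x: "x \<in> {0..1}"
    have "d + x > 0" "d + (1 - x) > 0" using x d by auto
    moreover have "((\<lambda>x. d + x) has_real_derivative 1) (at x)" "((\<lambda>x. d + (1 - x)) has_real_derivative - 1) (at x)"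
      by (auto intro!: derivative_eq_intros)
    ultimately have pow: "((\<lambda>x. (d + x) powr (\<alpha> - 1)) has_real_derivative (\<alpha> - 1) * (d + x) powr (\<alpha> - 2)) (at x)"
      "((\<lambda>x. (d + (1 - x)) powr (\<alpha> - 1)) has_real_derivative - ((\<alpha> - 1) * (d + (1 - x)) powr (\<alpha> - 2))) (at x)"
      using DERIV_fun_powr[of "\<lambda>x. d + x" 1 x "\<alpha> - 1"] DERIV_fun_powr[of "\<lambda>x. d + (1 - x)" "-1" x "\<alpha> - 1"]
      by (simp_all add: diff_diff_eq)
    have alg: "K / a * (a * p - - (a * q)) = K * (p + q)" if "a \<noteq> 0" for a p q :: real
    proof -
      have "a * p - - (a * q) = a * (p + q)" by (simp add: distrib_left)
      then show ?thesis using that by simp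
    qed
    have "(B has_real_derivative b x) (at x)"
      unfolding B_def b_def
      using DERIV_cmult[OF DERIV_diff[OF pow], of "K / (\<alpha> - 1)"] \<alpha> alg[of "\<alpha> - 1"] by simp
    then show "(B has_vector_derivative b x) (at x within {0..1})"
      by (simp add: has_real_derivative_iff_has_vector_derivative has_vector_derivative_at_within)
  qed simp
  then have "integral {0..1} b = B 1 - B 0" by (rule integral_unique)
  also have "\<dots> = 2 * K / (1 - \<alpha>) * (d powr (\<alpha> - 1) - (d + 1) powr (\<alpha> - 1))"
  proof -
    have "K / (\<alpha> - 1) * (q - p) - K / (\<alpha> - 1) * (p - q) = 2 * K / (1 - \<alpha>) * (p - q)" for p q :: real
    proof -
      define k where "k = K / (1 - \<alpha>)"
      have k: "K / (\<alpha> - 1) = - k" "2 * K / (1 - \<alpha>) = 2 * k"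
        unfolding k_def by (metis minus_diff_eq minus_divide_right) simp
      show ?thesis unfolding k by (simp add: algebra_simps)
    qed
    then show ?thesis by (simp add: B_def)
  qed
  also have "\<dots> \<le> 2 * K / (1 - \<alpha>) * d powr (\<alpha> - 1)"
    using K \<alpha> by (intro mult_left_mono) auto
  finally show ?thesis unfolding b_def .
qed

text \<open>Since \<open>t - r * \<zeta>\<close> is comparable to the sum of \<open>1 - r\<close> and the arc length from \<open>\<zeta>\<close> to \<open>t\<close>,
  the Hoelder condition turns the kernel into the \<open>\<alpha> - 2\<close>-nd power of that sum.\<close>

lemma holder_kernel_bound:
  fixes F k :: "complex \<Rightarrow> complex"
  assumes \<alpha>: "0 < \<alpha>" "\<alpha> < 1" and C: "C \<ge> 0"
    and hol: "\<And>x y. x \<in> unit_circle \<Longrightarrow> y \<in> unit_circle \<Longrightarrow> dist (F x) (F y) \<le> C * dist x y powr \<alpha>"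
    and \<zeta>: "norm \<zeta> = 1" and r: "0 \<le> r" "r < 1"
    and k: "continuous_on unit_circle k" and M: "M \<ge> 0"
      "\<And>t. t \<in> unit_circle \<Longrightarrow> norm (k t) \<le> M / (norm (t - of_real r * \<zeta>))\<^sup>2"
  shows "norm (contour_integral (circlepath 0 1) (\<lambda>t. (F t - F \<zeta>) * k t))
    \<le> 2 * pi * (16 * C * M) / (1 - \<alpha>) * (1 - r) powr (\<alpha> - 1)"
proof -
  define d where "d = 1 - r"
  have d: "d > 0" using r by (simp add: d_def)
  define c where "c = circlepath 0 1"
  have c_in: "c x \<in> unit_circle" for x by (simp add: c_def circlepath)
  have Fcont: "continuous_on unit_circle F"
    using holder_on_imp_continuous_on[of \<alpha> unit_circle F] \<alpha> hol unfolding holder_on_def by blast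
  define G where "G = (\<lambda>x. (F (\<zeta> * c x) - F \<zeta>) * k (\<zeta> * c x) * \<zeta> * (2 * pi * \<i> * c x))"
  \<comment> \<open>The 8 collects \<open>2 powr \<alpha> \<le> 2\<close> and
    \<open>2 powr (2 - \<alpha>) \<le> 4\<close>; integrating the two summands doubles it to the 16
    of the claim.\<close>
  define b where "b = (\<lambda>x. 2 * pi * (8 * C * M) * ((d + x) powr (\<alpha> - 2) + (d + (1 - x)) powr (\<alpha> - 2)))"
  have "contour_integral (circlepath 0 1) (\<lambda>t. (F t - F \<zeta>) * k t) = integral {0..1} G"
  proof (rule trans[OF contour_integral_circle_rotate[OF \<zeta>]])
    have "vector_derivative (circlepath 0 1) (at x) = 2 * pi * \<i> * c x" for x
      by (simp add: vector_derivative_circlepath c_def) (simp add: circlepath)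
    then show "contour_integral (circlepath 0 1) (\<lambda>u. (F (\<zeta> * u) - F \<zeta>) * k (\<zeta> * u) * \<zeta>) = integral {0..1} G"
      unfolding contour_integral_integral G_def by (simp only: c_def)
  qed
  moreover have "norm (integral {0..1} G) \<le> integral {0..1} b"
  proof (rule integral_norm_bound_integral)
    have ccont: "continuous_on {0..1} c"
      unfolding c_def using path_circlepath path_def by blast
    have "continuous_on {0..1} G"
      unfolding G_def
      by (intro continuous_intros ccont continuous_on_compose2[OF Fcont] continuous_on_compose2[OF k])
        (use c_in \<zeta> in \<open>auto simp: norm_mult\<close>)
    then show "G integrable_on {0..1}" by (rule integrable_continuous_real)
    have "continuous_on {0..1} b"
      unfolding b_def using d by (intro continuous_intros) auto
    then show "b integrable_on {0..1}" by (rule integrable_continuous_real)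
    fix x :: real assume x: "x \<in> {0..1}"
    define u where "u = c x"
    have u: "norm u = 1" using c_in[of x] by (simp add: u_def)
    define m where "m = min x (1 - x)"
    have m: "m \<ge> 0" using x by (simp add: m_def)
    have "norm u \<le> norm (u - of_real r) + norm (complex_of_real r)"
      using norm_triangle_sub[of u "of_real r"] by simp
    then have D: "d \<le> norm (u - of_real r)" using u r by (simp add: d_def)
    have "norm (u - 1) \<le> norm (u - of_real r) + norm (of_real r - (1::complex))"
      using norm_triangle_ineq[of "u - of_real r" "of_real r - 1"] by simp
    also have "of_real r - (1::complex) = - of_real d" by (simp add: d_def)
    also have "norm \<dots> = d" using d by simp
    finally have U: "norm (u - 1) \<le> 2 * norm (u - of_real r)" using D by simp
    have "2 * m \<le> norm (u - 1)"
      using norm_circlepath_minus_1[of x] x by (simp add: u_def c_def m_def)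
    \<comment> \<open>The distance dominates both \<open>d\<close> and \<open>m\<close>, hence also
      their mean.\<close>
    then have low: "(d + m) / 2 \<le> norm (u - of_real r)" using U D by (simp add: field_simps)
    have pos: "norm (u - of_real r) > 0" using D d by linarith
    have "norm (F (\<zeta> * u) - F \<zeta>) \<le> C * norm (\<zeta> * u - \<zeta>) powr \<alpha>"
      using hol[of "\<zeta> * u" \<zeta>] \<zeta> u by (simp add: dist_norm norm_mult)
    also have "\<zeta> * u - \<zeta> = \<zeta> * (u - 1)" by (simp add: right_diff_distrib)
    also have "norm \<dots> = norm (u - 1)" using \<zeta> by (simp add: norm_mult)
    also have "C * norm (u - 1) powr \<alpha> \<le> C * (2 * norm (u - of_real r)) powr \<alpha>"
      using U C \<alpha> by (intro mult_left_mono powr_mono2) auto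
    finally have 1: "norm (F (\<zeta> * u) - F \<zeta>) \<le> C * (2 * norm (u - of_real r)) powr \<alpha>" .
    have "\<zeta> * u - of_real r * \<zeta> = \<zeta> * (u - of_real r)" by (simp add: right_diff_distrib)
    then have "norm (\<zeta> * u - of_real r * \<zeta>) = norm (u - of_real r)"
      using \<zeta> by (simp add: norm_mult)
    then have 2: "norm (k (\<zeta> * u)) \<le> M / (norm (u - of_real r))\<^sup>2"
      using M(2)[of "\<zeta> * u"] \<zeta> u by (simp add: norm_mult)
    have "norm (G x) = 2 * pi * (norm (F (\<zeta> * u) - F \<zeta>) * norm (k (\<zeta> * u)))"
      using \<zeta> u by (simp add: G_def u_def[symmetric] norm_mult)
    also have "\<dots> \<le> 2 * pi * (C * (2 * norm (u - of_real r)) powr \<alpha> * (M / (norm (u - of_real r))\<^sup>2))"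
      using 1 2 C by (intro mult_left_mono mult_mono) auto
    also have "\<dots> = 2 * pi * (C * M) * (2 powr \<alpha> * norm (u - of_real r) powr (\<alpha> - 2))"
      using pos by (simp add: powr_mult powr_diff)
    also have "\<dots> \<le> 2 * pi * (C * M) * (2 * (4 * (d + m) powr (\<alpha> - 2)))"
    proof (intro mult_left_mono mult_mono)
      show "2 powr \<alpha> \<le> (2::real)" using \<alpha> powr_mono[of \<alpha> 1 "2::real"] by simp
      have "norm (u - of_real r) powr (\<alpha> - 2) \<le> ((d + m) / 2) powr (\<alpha> - 2)"
        using low d m \<alpha> by (intro powr_mono2') auto
      also have "\<dots> = 2 powr (2 - \<alpha>) * (d + m) powr (\<alpha> - 2)"
        using d m by (simp add: powr_divide powr_diff)
      also have "\<dots> \<le> 4 * (d + m) powr (\<alpha> - 2)"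
        using \<alpha> powr_mono[of "2 - \<alpha>" 2 "2::real"] by (intro mult_right_mono) auto
      finally show "norm (u - of_real r) powr (\<alpha> - 2) \<le> 4 * (d + m) powr (\<alpha> - 2)" .
    qed (use C M in auto)
    also have "\<dots> = 2 * pi * (8 * C * M) * (d + m) powr (\<alpha> - 2)" by simp
    also have "\<dots> \<le> b x"
      unfolding b_def
    proof (rule mult_left_mono)
      show "(d + m) powr (\<alpha> - 2) \<le> (d + x) powr (\<alpha> - 2) + (d + (1 - x)) powr (\<alpha> - 2)"
        by (auto simp: m_def min_def)
    qed (use C M in auto)
    finally show "norm (G x) \<le> b x" .
  qed
  moreover have "integral {0..1} b \<le> 2 * pi * (16 * C * M) / (1 - \<alpha>) * d powr (\<alpha> - 1)"
    unfolding b_def using integral_two_sided_powr_le[OF d \<alpha>(2), of "2 * pi * (8 * C * M)"] C M by simp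
  ultimately show ?thesis unfolding d_def by (metis order_trans)
qed

section \<open>Cauchy integrals in the disk and their extension to the circle\<close>

definition cauchy_circle :: "(complex \<Rightarrow> complex) \<Rightarrow> complex \<Rightarrow> complex" where
  "cauchy_circle F z = 1 / (2 * of_real pi * \<i>) * contour_integral (circlepath 0 1) (\<lambda>t. F t / (t - z))"

lemma cauchy_circle_has_field_derivative:
  assumes "continuous_on unit_circle F" "norm z < 1"
  shows "(cauchy_circle F has_field_derivative
    1 / (2 * of_real pi * \<i>) * contour_integral (circlepath 0 1) (\<lambda>t. F t / (t - z)\<^sup>2)) (at z)"
proof -
  have "((\<lambda>w. contour_integral (circlepath 0 1) (\<lambda>t. F t / (t - w))) has_field_derivative
      (of_nat 1 * contour_integral (circlepath 0 1) (\<lambda>t. F t / (t - z) ^ (Suc 1)))) (at z)"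
  proof (rule Cauchy_next_derivative_circlepath(2))
    fix w :: complex assume w: "w \<in> ball 0 1"
    have "continuous_on (path_image (circlepath 0 1)) (\<lambda>t. F t / (t - w))"
      using assms w by (intro continuous_intros) auto
    then have "(\<lambda>t. F t / (t - w)) contour_integrable_on (circlepath 0 1)"
      by (rule contour_integrable_continuous_circlepath)
    then show "((\<lambda>t. F t / (t - w) ^ 1) has_contour_integral
        contour_integral (circlepath 0 1) (\<lambda>t. F t / (t - w))) (circlepath 0 1)"
      by (simp add: has_contour_integral_integral)
  qed (use assms in auto)
  from DERIV_cmult[OF this, of "1 / (2 * of_real pi * \<i>)"]
  show ?thesis
    unfolding cauchy_circle_def[abs_def] by (simp add: numeral_2_eq_2)
qed

text \<open>Cauchy's formulas for the constant function 1. They show what subtracting a boundary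
  value of the density under the integral costs: that value itself, up to the factor
  \<open>2 * pi * \<i>\<close>, for the simple kernel, and nothing for the squared one.\<close>

lemma contour_integral_circle_inverse:
  assumes "norm z < 1"
  shows "contour_integral (circlepath 0 1) (\<lambda>t. 1 / (t - z)) = 2 * of_real pi * \<i>"
    and "contour_integral (circlepath 0 1) (\<lambda>t. 1 / (t - z)\<^sup>2) = 0"
proof -
  have *: "((\<lambda>u. 1 / (u - z) ^ Suc k) has_contour_integral
      2 * pi * \<i> / fact k * (deriv ^^ k) (\<lambda>_. 1) z) (circlepath 0 1)" for k
    by (rule Cauchy_has_contour_integral_higher_derivative_circlepath) (use assms in auto)
  show "contour_integral (circlepath 0 1) (\<lambda>t. 1 / (t - z)) = 2 * of_real pi * \<i>"
    using contour_integral_unique[OF *[of 0]] by simp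
  show "contour_integral (circlepath 0 1) (\<lambda>t. 1 / (t - z)\<^sup>2) = 0"
    using contour_integral_unique[OF *[of 1]] by (simp add: power2_eq_square)
qed

lemma contour_integral_circle_inverse_outside:
  assumes "norm z > 1"
  shows "contour_integral (circlepath 0 1) (\<lambda>t. 1 / (t - z)) = 0"
proof (rule contour_integral_unique, rule Cauchy_theorem_disc_simple)
  show "(\<lambda>t. 1 / (t - z)) holomorphic_on ball 0 (norm z)"
    by (intro holomorphic_intros) auto
qed (use assms in auto)

lemma unit_polar:
  obtains \<zeta> :: complex where "norm \<zeta> = 1" "z = of_real (norm z) * \<zeta>"
proof (cases "z = 0")
  case True
  then show ?thesis using that[of 1] by simp
next
  case False
  then show ?thesis using that[of "z / of_real (norm z)"] by (simp add: norm_divide)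
qed

text \<open>As the squared kernel integrates to 0, \<open>F \<zeta>\<close> can be subtracted from
  \<open>F t\<close>, where \<open>\<zeta>\<close> is the radial projection of \<open>z\<close> to
  the circle. The Hoelder condition then weakens the singularity of the kernel.\<close>

lemma cauchy_circle_deriv_bound:
  assumes \<alpha>: "0 < \<alpha>" "\<alpha> < 1" and C: "C \<ge> 0"
    and hol: "\<And>x y. x \<in> unit_circle \<Longrightarrow> y \<in> unit_circle \<Longrightarrow> dist (F x) (F y) \<le> C * dist x y powr \<alpha>"
    and z: "norm z < 1"
  shows "norm (1 / (2 * of_real pi * \<i>) * contour_integral (circlepath 0 1) (\<lambda>t. F t / (t - z)\<^sup>2))
    \<le> 16 * C / (1 - \<alpha>) * (1 - norm z) powr (\<alpha> - 1)"
proof -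
  obtain \<zeta> where \<zeta>: "norm \<zeta> = 1" "z = of_real (norm z) * \<zeta>" by (rule unit_polar)
  have Fcont: "continuous_on unit_circle F"
    using holder_on_imp_continuous_on[of \<alpha> unit_circle F] \<alpha> hol unfolding holder_on_def by blast
  have nz: "t \<noteq> z" if "t \<in> unit_circle" for t using z that by auto
  have kcont: "continuous_on unit_circle (\<lambda>t. 1 / (t - z)\<^sup>2)"
    using nz by (intro continuous_intros) auto
  have int: "(\<lambda>t. (F t - F \<zeta>) * (1 / (t - z)\<^sup>2)) contour_integrable_on circlepath 0 1"
    "(\<lambda>t. F \<zeta> * (1 / (t - z)\<^sup>2)) contour_integrable_on circlepath 0 1"
    using nz Fcont by (intro contour_integrable_continuous_circlepath continuous_intros; simp)+
  have "contour_integral (circlepath 0 1) (\<lambda>t. F t / (t - z)\<^sup>2) =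
      contour_integral (circlepath 0 1) (\<lambda>t. (F t - F \<zeta>) * (1 / (t - z)\<^sup>2) + F \<zeta> * (1 / (t - z)\<^sup>2))"
    by (simp add: diff_divide_distrib add_divide_distrib[symmetric])
  also have "\<dots> = contour_integral (circlepath 0 1) (\<lambda>t. (F t - F \<zeta>) * (1 / (t - z)\<^sup>2))
      + contour_integral (circlepath 0 1) (\<lambda>t. F \<zeta> * (1 / (t - z)\<^sup>2))"
    by (rule contour_integral_add[OF int])
  also have "contour_integral (circlepath 0 1) (\<lambda>t. F \<zeta> * (1 / (t - z)\<^sup>2)) = 0"
    using contour_integral_lmul[of "\<lambda>t. 1 / (t - z)\<^sup>2" "circlepath 0 1" "F \<zeta>"]
      contour_integral_circle_inverse(2)[OF z] kcont contour_integrable_continuous_circlepath[of 0 1] by simp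
  finally have eq: "contour_integral (circlepath 0 1) (\<lambda>t. F t / (t - z)\<^sup>2) =
      contour_integral (circlepath 0 1) (\<lambda>t. (F t - F \<zeta>) * (1 / (t - z)\<^sup>2))" by simp
  have "norm (contour_integral (circlepath 0 1) (\<lambda>t. (F t - F \<zeta>) * (1 / (t - z)\<^sup>2)))
      \<le> 2 * pi * (16 * C * 1) / (1 - \<alpha>) * (1 - norm z) powr (\<alpha> - 1)"
  proof (rule holder_kernel_bound[OF \<alpha> C hol \<zeta>(1) _ z kcont])
    show "norm (1 / (t - z)\<^sup>2) \<le> 1 / (norm (t - of_real (norm z) * \<zeta>))\<^sup>2" for t
      using \<zeta>(2) by (simp add: norm_divide norm_power)
  qed auto
  also have "\<dots> = 2 * pi * (16 * C / (1 - \<alpha>) * (1 - norm z) powr (\<alpha> - 1))" by simp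
  finally have "norm (contour_integral (circlepath 0 1) (\<lambda>t. F t / (t - z)\<^sup>2)) / (2 * pi)
      \<le> 16 * C / (1 - \<alpha>) * (1 - norm z) powr (\<alpha> - 1)"
    unfolding eq by (simp only: pos_divide_le_eq mult_ac pi_gt_zero zero_less_mult_iff zero_less_numeral simp_thms)
  moreover have "norm (1 / (2 * of_real pi * \<i>) * X) = norm X / (2 * pi)" for X :: complex
    by (simp add: norm_mult norm_divide)
  ultimately show ?thesis by (simp only:)
qed

text \<open>The Hardy-Littlewood argument: go from \<open>z\<close> radially inwards, across, and
  radially outwards to \<open>w\<close>. With \<open>\<delta>\<close> comparable to the distance of
  the points, each piece costs at most a multiple of \<open>\<delta> powr \<alpha>\<close>.\<close>

lemma holder_of_deriv_bound:
  fixes K K' :: "complex \<Rightarrow> complex"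
  assumes \<alpha>: "0 < \<alpha>" "\<alpha> < 1" and B: "B \<ge> 0"
    and der: "\<And>z. norm z < 1 \<Longrightarrow> (K has_field_derivative K' z) (at z)"
    and bnd: "\<And>z. norm z < 1 \<Longrightarrow> norm (K' z) \<le> B * (1 - norm z) powr (\<alpha> - 1)"
    and zw: "norm z < 1" "norm w < 1"
  shows "dist (K z) (K w) \<le> (2 / \<alpha> + 2) * B * dist z w powr \<alpha>"
proof (cases "z = w")
  case False
  \<comment> \<open>Half the distance, because points of the disk can be almost 2 apart and
    \<open>\<delta> < 1\<close> is needed.\<close>
  define \<delta> where "\<delta> = dist z w / 2"
  have "dist z w \<le> norm z + norm w" by (simp add: dist_norm norm_triangle_ineq4)
  then have \<delta>: "0 < \<delta>" "\<delta> < 1" using zw False by (auto simp: \<delta>_def)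
  have radial: "norm (K z - K (of_real (1 - \<delta>) * z)) \<le> B / \<alpha> * \<delta> powr \<alpha>" if z: "norm z < 1" for z
  proof -
    have sz: "norm (of_real s * z) \<le> s" if "0 \<le> s" for s
      using z that by (simp add: norm_mult mult_left_le)
    \<comment> \<open>The bound on the derivative may blow up at the outer end of the radius. Its
      antiderivative in \<open>s\<close>, a multiple of \<open>(1 - s) powr \<alpha>\<close>, is
      still continuous there because \<alpha> > 0.\<close>
    have "norm (K (of_real 1 * z) - K (of_real (1 - \<delta>) * z))
        \<le> - (B / \<alpha> * (1 - 1) powr \<alpha>) - (- (B / \<alpha> * (1 - (1 - \<delta>)) powr \<alpha>))"
    proof (rule differentiable_bound_general[where f = "\<lambda>s. K (of_real s * z)" and \<phi> = "\<lambda>s. - (B / \<alpha> * (1 - s) powr \<alpha>)"])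
      have Kd: "((\<lambda>s. K (of_real s * z)) has_vector_derivative z * K' (of_real s * z)) (at s)"
        if "norm (of_real s * z) < 1" for s
      proof -
        have "((\<lambda>s. of_real s * z) has_vector_derivative z) (at s)"
          by (auto intro!: derivative_eq_intros)
        from field_vector_diff_chain_at[OF this der[OF that]]
        show ?thesis by (simp add: o_def)
      qed
      have Kn: "norm (of_real s * z) < 1" if "1 - \<delta> \<le> s" "s \<le> 1" for s
      proof -
        have "norm (of_real s * z) \<le> 1 * norm z"
          using that \<delta> unfolding norm_mult by (intro mult_right_mono) auto
        then show ?thesis using z by simp
      qed
      show "continuous_on {1 - \<delta>..1} (\<lambda>s. K (of_real s * z))"
        using Kd Kn by (intro continuous_at_imp_continuous_on ballI has_vector_derivative_continuous) auto
      show "continuous_on {1 - \<delta>..1} (\<lambda>s. - (B / \<alpha> * (1 - s) powr \<alpha>))"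
        using \<alpha> by (intro continuous_intros continuous_on_powr') auto
      fix s assume s: "1 - \<delta> < s" "s < 1"
      show "((\<lambda>s. K (of_real s * z)) has_vector_derivative z * K' (of_real s * z)) (at s)"
        using Kd Kn s by auto
      have "((\<lambda>s. 1 - s) has_real_derivative - 1) (at s)"
        by (auto intro!: derivative_eq_intros)
      from DERIV_cmult[OF DERIV_fun_powr[OF this, of \<alpha>], of "- (B / \<alpha>)"] s \<alpha>
      have "((\<lambda>s. - (B / \<alpha> * (1 - s) powr \<alpha>)) has_real_derivative B * (1 - s) powr (\<alpha> - 1)) (at s)"
        by simp
      then show "((\<lambda>s. - (B / \<alpha> * (1 - s) powr \<alpha>)) has_vector_derivative B * (1 - s) powr (\<alpha> - 1)) (at s)"
        by (simp add: has_real_derivative_iff_has_vector_derivative)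
      have "norm (z * K' (of_real s * z)) \<le> 1 * (B * (1 - norm (of_real s * z)) powr (\<alpha> - 1))"
        unfolding norm_mult[of z] using z bnd[of "of_real s * z"] Kn[of s] s
        by (intro mult_mono) auto
      also have "\<dots> \<le> 1 * (B * (1 - s) powr (\<alpha> - 1))"
        using sz[of s] s \<delta> \<alpha> B by (intro mult_left_mono powr_mono2') auto
      finally show "norm (z * K' (of_real s * z)) \<le> B * (1 - s) powr (\<alpha> - 1)" by simp
    qed (use \<delta> in auto)
    then show ?thesis using \<alpha> by simp
  qed
  \<comment> \<open>Both contracted points lie in the convex set
    \<open>cball 0 (1 - \<delta>)\<close>, on which the derivative is at most
    \<open>B * \<delta> powr (\<alpha> - 1)\<close>.\<close>
  have horizontal: "norm (K (of_real (1 - \<delta>) * z) - K (of_real (1 - \<delta>) * w))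
      \<le> (B * \<delta> powr (\<alpha> - 1)) * norm (of_real (1 - \<delta>) * z - of_real (1 - \<delta>) * w)"
  proof (rule field_differentiable_bound[where S = "cball 0 (1 - \<delta>)"])
    fix x :: complex assume x: "x \<in> cball 0 (1 - \<delta>)"
    then have x1: "norm x < 1" using \<delta> by simp
    show "(K has_field_derivative K' x) (at x within cball 0 (1 - \<delta>))"
      using der[OF x1] by (rule DERIV_subset) simp
    show "norm (K' x) \<le> B * \<delta> powr (\<alpha> - 1)"
      using bnd[OF x1] by (rule order_trans) (use x \<delta> \<alpha> B in \<open>intro mult_left_mono powr_mono2'; auto\<close>)
  qed (use zw \<delta> in \<open>auto simp: norm_mult mult_left_le simp del: of_real_diff\<close>)
  have "of_real (1 - \<delta>) * z - of_real (1 - \<delta>) * w = of_real (1 - \<delta>) * (z - w)"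
    by (simp add: algebra_simps)
  also have "norm \<dots> \<le> 1 * (2 * \<delta>)"
    unfolding norm_mult \<delta>_def using \<delta> by (intro mult_mono) (auto simp: dist_norm \<delta>_def simp del: of_real_diff)
  finally have "(B * \<delta> powr (\<alpha> - 1)) * norm (of_real (1 - \<delta>) * z - of_real (1 - \<delta>) * w)
      \<le> (B * \<delta> powr (\<alpha> - 1)) * (1 * (2 * \<delta>))"
    using B by (intro mult_left_mono) auto
  also have "\<dots> = 2 * B * \<delta> powr \<alpha>" using \<delta> by (simp add: powr_diff)
  finally have mid: "norm (K (of_real (1 - \<delta>) * z) - K (of_real (1 - \<delta>) * w)) \<le> 2 * B * \<delta> powr \<alpha>"
    using horizontal by linarith
  have "dist (K z) (K w) = norm ((K z - K (of_real (1 - \<delta>) * z)) +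
      (K (of_real (1 - \<delta>) * z) - K (of_real (1 - \<delta>) * w)) - (K w - K (of_real (1 - \<delta>) * w)))"
    by (simp add: dist_norm)
  also have "\<dots> \<le> norm (K z - K (of_real (1 - \<delta>) * z)) +
      norm (K (of_real (1 - \<delta>) * z) - K (of_real (1 - \<delta>) * w)) + norm (K w - K (of_real (1 - \<delta>) * w))"
    by (meson norm_triangle_ineq norm_triangle_ineq4 order_trans add_right_mono)
  also have "\<dots> \<le> B / \<alpha> * \<delta> powr \<alpha> + 2 * B * \<delta> powr \<alpha> + B / \<alpha> * \<delta> powr \<alpha>"
    using radial[OF zw(1)] radial[OF zw(2)] mid by linarith
  also have "\<dots> = (2 / \<alpha> + 2) * B * \<delta> powr \<alpha>"
    by (simp add: algebra_simps)
  also have "\<dots> \<le> (2 / \<alpha> + 2) * B * dist z w powr \<alpha>"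
    using \<alpha> B \<delta> by (intro mult_left_mono powr_mono2) (auto simp: \<delta>_def)
  finally show ?thesis .
qed simp

text \<open>The Hoelder bound gives uniform continuity, hence a continuous extension, and it
  survives the passage to the limit along radii.\<close>

lemma disk_algebra_extension:
  fixes K :: "complex \<Rightarrow> complex"
  assumes \<alpha>: "\<alpha> > 0" and C: "C \<ge> 0" and holo: "K holomorphic_on unit_disk"
    and hol: "\<And>z w. norm z < 1 \<Longrightarrow> norm w < 1 \<Longrightarrow> dist (K z) (K w) \<le> C * dist z w powr \<alpha>"
  obtains \<Phi> where "\<Phi> \<in> disk_algebra" "holder_on \<alpha> (cball 0 1) \<Phi>" "\<And>z. norm z < 1 \<Longrightarrow> \<Phi> z = K z"
proof -
  have "uniformly_continuous_on unit_disk K"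
    unfolding uniformly_continuous_on_def
  proof (intro allI impI)
    fix e :: real assume e: "e > 0"
    \<comment> \<open>Then \<open>C * d powr \<alpha>\<close> equals
      \<open>C * (e / (C + 1))\<close>, which is below \<open>e\<close> even for
      \<open>C = 0\<close>.\<close>
    define d where "d = (e / (C + 1)) powr (1 / \<alpha>)"
    have "d > 0" using e C by (simp add: d_def)
    moreover have "dist (K y) (K x) < e" if "x \<in> unit_disk" "y \<in> unit_disk" "dist y x < d" for x y
    proof -
      have "C * dist y x powr \<alpha> \<le> C * d powr \<alpha>"
        using that \<alpha> C by (intro mult_left_mono powr_mono2) auto
      also have "d powr \<alpha> = e / (C + 1)" using \<alpha> e C by (simp add: d_def powr_powr)
      also have "C * (e / (C + 1)) < e" using C e by (simp add: field_simps)
      finally show ?thesis using hol[of y x] that by simp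
    qed
    ultimately show "\<exists>d>0. \<forall>x\<in>unit_disk. \<forall>x'\<in>unit_disk. dist x' x < d \<longrightarrow> dist (K x') (K x) < e"
      by blast
  qed
  then obtain \<Phi> where \<Phi>: "uniformly_continuous_on (closure unit_disk) \<Phi>" "\<And>x. x \<in> unit_disk \<Longrightarrow> K x = \<Phi> x"
    using uniformly_continuous_on_extension_on_closure by metis
  have cont: "continuous_on (cball 0 1) \<Phi>"
    using uniformly_continuous_imp_continuous[OF \<Phi>(1)] by simp
  have "\<Phi> holomorphic_on unit_disk"
    using holo \<Phi>(2) by (metis holomorphic_transform)
  then have "\<Phi> \<in> disk_algebra" using cont by (simp add: disk_algebra_def)
  moreover have "dist (\<Phi> x) (\<Phi> y) \<le> C * dist x y powr \<alpha>" if xy: "x \<in> cball 0 1" "y \<in> cball 0 1" for x y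
  proof -
    define s where "s = (\<lambda>n. complex_of_real (1 - inverse (real (Suc n))))"
    have sn: "norm (s n) < 1" for n
      unfolding s_def norm_of_real by (simp add: abs_less_iff inverse_eq_divide)
    have "s \<longlonglongrightarrow> of_real (1 - 0)"
      unfolding s_def by (intro tendsto_intros LIMSEQ_inverse_real_of_nat)
    then have s1: "s \<longlonglongrightarrow> 1" by simp
    have lim: "(\<lambda>n. s n * x) \<longlonglongrightarrow> x" for x using tendsto_mult_right[OF s1, of x] by simp
    have ball: "norm (s n * x) < 1" if "x \<in> cball 0 1" for n x
    proof -
      have "norm (s n * x) \<le> norm (s n) * 1"
        using that unfolding norm_mult by (intro mult_left_mono) auto
      then show ?thesis using sn[of n] by simp
    qed
    have lim\<Phi>: "(\<lambda>n. \<Phi> (s n * x)) \<longlonglongrightarrow> \<Phi> x" if "x \<in> cball 0 1" for x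
      using continuous_on_tendsto_compose[OF cont lim that] ball[OF that] by (auto simp: less_imp_le)
    have "(\<lambda>n. dist (\<Phi> (s n * x)) (\<Phi> (s n * y))) \<longlonglongrightarrow> dist (\<Phi> x) (\<Phi> y)"
      by (intro tendsto_intros lim\<Phi> xy)
    moreover have "(\<lambda>n. C * dist (s n * x) (s n * y) powr \<alpha>) \<longlonglongrightarrow> C * dist x y powr \<alpha>"
      using \<alpha> by (intro tendsto_intros tendsto_powr2 lim always_eventually) auto
    ultimately show ?thesis
    proof (rule LIMSEQ_le, intro exI allI impI)
      fix n
      show "dist (\<Phi> (s n * x)) (\<Phi> (s n * y)) \<le> C * dist (s n * x) (s n * y) powr \<alpha>"
        using hol[of "s n * x" "s n * y"] \<Phi>(2) ball xy by simp
    qed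
  qed
  then have "holder_on \<alpha> (cball 0 1) \<Phi>" unfolding holder_on_def by blast
  ultimately show thesis using that \<Phi>(2) by simp
qed

text \<open>Substituting \<open>cnj t\<close> for \<open>t\<close> changes the kernel into
  \<open>1 / (t - z) - 1 / t\<close>. The second term makes the right-hand side vanish at the
  origin, as the anti-analytic part does at infinity.\<close>

lemma anti_analytic_part_inverse:
  assumes cont: "continuous_on unit_circle f" and z: "z \<noteq> 0" "norm z < 1"
  shows "anti_analytic_part f (1 / z) = cauchy_circle (f \<circ> cnj) z - cauchy_circle (f \<circ> cnj) 0"
proof -
  have cont': "continuous_on unit_circle (\<lambda>t. f (cnj t))"
    by (intro continuous_on_compose2[OF cont] continuous_intros) auto
  have int: "(\<lambda>t. f (cnj t) / (t - w)) contour_integrable_on circlepath 0 1" if "norm w < 1" for w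
    using cont' that by (intro contour_integrable_continuous_circlepath continuous_intros) auto
  have "contour_integral (circlepath 0 1) (\<lambda>t. f t / (1 / z - t)) =
      contour_integral (circlepath 0 1) (\<lambda>t. f (cnj t) / (1 / z - cnj t) * (cnj t)\<^sup>2)"
    by (rule contour_integral_circle_cnj)
  also have "\<dots> = contour_integral (circlepath 0 1) (\<lambda>t. f (cnj t) / (t - z) - f (cnj t) / (t - 0))"
  proof (rule contour_integral_cong)
    fix t assume "t \<in> path_image (circlepath 0 1)"
    then have t: "norm t = 1" by simp
    then have "cnj t = 1 / t" using divide_conv_cnj[OF t, of 1] by simp
    moreover have "t \<noteq> 0" "t \<noteq> z" using t z by auto
    moreover have "1 / z - 1 / t = (t - z) / (z * t)" using calculation z by (simp add: field_simps)
    ultimately have "f (cnj t) / (1 / z - cnj t) * (cnj t)\<^sup>2 = f (cnj t) * (z / (t * (t - z)))"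
      by (simp add: power2_eq_square)
    also have "z / (t * (t - z)) = 1 / (t - z) - 1 / t"
      using \<open>t \<noteq> 0\<close> \<open>t \<noteq> z\<close> by (simp add: field_simps)
    finally show "f (cnj t) / (1 / z - cnj t) * (cnj t)\<^sup>2 = f (cnj t) / (t - z) - f (cnj t) / (t - 0)"
      by (simp add: right_diff_distrib)
  qed simp
  also have "\<dots> = contour_integral (circlepath 0 1) (\<lambda>t. f (cnj t) / (t - z))
      - contour_integral (circlepath 0 1) (\<lambda>t. f (cnj t) / (t - 0))"
    by (rule contour_integral_diff) (use z in \<open>intro int; simp\<close>)+
  finally show ?thesis
    by (simp add: anti_analytic_part_def cauchy_circle_def right_diff_distrib diff_divide_distrib)
qed

text \<open>A quantitative jump relation; it is a sum because the two Cauchy kernels have opposite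
  signs. The second point is the reflection of the first in the circle, so the kernels combine to
  \<open>k\<close>, whose modulus is the Poisson kernel and whose integral is
  \<open>2 * pi * \<i>\<close>. Hence \<open>f \<zeta>\<close> can be moved under the
  integral.\<close>

lemma plemelj_bound:
  assumes \<alpha>: "0 < \<alpha>" "\<alpha> < 1" and C: "C \<ge> 0"
    and hol: "\<And>x y. x \<in> unit_circle \<Longrightarrow> y \<in> unit_circle \<Longrightarrow> dist (f x) (f y) \<le> C * dist x y powr \<alpha>"
    and \<zeta>: "norm \<zeta> = 1" and r: "0 < r" "r < 1"
  shows "norm (cauchy_circle f (of_real r * \<zeta>) + anti_analytic_part f (1 / (of_real r * cnj \<zeta>)) - f \<zeta>)
    \<le> 32 * C / (1 - \<alpha>) * (1 - r) powr \<alpha>"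
proof -
  define z where "z = of_real r * \<zeta>"
  define w where "w = \<zeta> / of_real r"
  have \<zeta>0: "\<zeta> \<noteq> 0" using \<zeta> by auto
  have w_eq: "1 / (of_real r * cnj \<zeta>) = w"
    using \<zeta> r \<zeta>0 unfolding w_def by (simp add: divide_simps) (simp add: complex_norm_square[symmetric] mult.commute)
  have nzw: "norm z < 1" "norm w > 1" using \<zeta> r by (auto simp: z_def w_def norm_mult norm_divide)
  have Fcont: "continuous_on unit_circle f"
    using holder_on_imp_continuous_on[of \<alpha> unit_circle f] \<alpha> hol unfolding holder_on_def by blast
  have ne: "t \<noteq> z" "t \<noteq> w" if "t \<in> unit_circle" for t using that nzw by auto
  define k where "k = (\<lambda>t. 1 / (t - z) - 1 / (t - w))"
  have kcont: "continuous_on unit_circle k"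
    unfolding k_def using ne by (intro continuous_intros) auto
  have knorm: "norm (k t) \<le> (1 - r\<^sup>2) / (norm (t - of_real r * \<zeta>))\<^sup>2" if t: "t \<in> unit_circle" for t
  proof -
    have "norm (t - w) = norm (of_real r * t - \<zeta>) / r"
    proof -
      have "t - w = (of_real r * t - \<zeta>) / of_real r" using r by (simp add: w_def field_simps)
      then show ?thesis using r by (simp add: norm_divide)
    qed
    \<comment> \<open>For two points of the unit circle it does not matter for the distance which of
      them carries the factor \<open>r\<close>.\<close>
    also have "norm (of_real r * t - \<zeta>) = norm (t - z)"
    proof -
      have "(norm (of_real r * t - \<zeta>))\<^sup>2 = (norm (t - z))\<^sup>2"
      proof -
        have "(norm (of_real r * t - \<zeta>))\<^sup>2 - (norm (t - z))\<^sup>2 = (r\<^sup>2 - 1) * ((norm t)\<^sup>2 - (norm \<zeta>)\<^sup>2)"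
          unfolding cmod_power2 z_def by (simp add: algebra_simps power2_eq_square)
        then show ?thesis using t \<zeta> by simp
      qed
      then show ?thesis by simp
    qed
    finally have nw: "norm (t - w) = norm (t - z) / r" .
    have "k t = (z - w) / ((t - z) * (t - w))"
      unfolding k_def using ne[OF t] by (simp add: field_simps)
    moreover have "z - w = - (of_real ((1 - r\<^sup>2) / r) * \<zeta>)"
      using r by (simp add: z_def w_def field_simps power2_eq_square)
    moreover have "norm (of_real ((1 - r\<^sup>2) / r) * \<zeta>) = (1 - r\<^sup>2) / r"
      using r \<zeta> by (simp add: norm_mult power_le_one del: of_real_divide of_real_diff)
    ultimately have "norm (k t) = (1 - r\<^sup>2) / r / (norm (t - z) * norm (t - w))"
      by (simp only: norm_divide norm_mult norm_minus_cancel)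
    also have "\<dots> = (1 - r\<^sup>2) / (norm (t - z))\<^sup>2"
      unfolding nw using r by (simp add: power2_eq_square)
    finally show ?thesis by (simp add: z_def)
  qed
  have int: "(\<lambda>t. f t / (t - z)) contour_integrable_on circlepath 0 1"
    "(\<lambda>t. f t / (w - t)) contour_integrable_on circlepath 0 1"
    "(\<lambda>t. f \<zeta> / (t - z)) contour_integrable_on circlepath 0 1"
    "(\<lambda>t. f \<zeta> / (t - w)) contour_integrable_on circlepath 0 1"
    "(\<lambda>t. 1 / (t - z)) contour_integrable_on circlepath 0 1"
    "(\<lambda>t. 1 / (t - w)) contour_integrable_on circlepath 0 1"
    using ne nzw Fcont by (intro contour_integrable_continuous_circlepath continuous_intros; auto)+
  have c1: "contour_integral (circlepath 0 1) (\<lambda>t. f \<zeta> / (t - z)) = f \<zeta> * (2 * of_real pi * \<i>)"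
    using contour_integral_lmul[of "\<lambda>t. 1 / (t - z)" "circlepath 0 1" "f \<zeta>"]
      contour_integral_circle_inverse(1)[OF nzw(1)] int(5)
    by simp
  have c2: "contour_integral (circlepath 0 1) (\<lambda>t. f \<zeta> / (t - w)) = 0"
    using contour_integral_lmul[of "\<lambda>t. 1 / (t - w)" "circlepath 0 1" "f \<zeta>"]
      contour_integral_circle_inverse_outside[OF nzw(2)] int(6)
    by simp
  have "contour_integral (circlepath 0 1) (\<lambda>t. (f t - f \<zeta>) * k t) =
      contour_integral (circlepath 0 1)
        (\<lambda>t. (f t / (t - z) + f t / (w - t)) - (f \<zeta> / (t - z) - f \<zeta> / (t - w)))"
  proof (rule contour_integral_cong)
    fix t :: complex
    have "f t / (w - t) = - (f t / (t - w))" by (metis minus_diff_eq minus_divide_right)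
    then show "(f t - f \<zeta>) * k t = (f t / (t - z) + f t / (w - t)) - (f \<zeta> / (t - z) - f \<zeta> / (t - w))"
      by (simp add: k_def algebra_simps diff_divide_distrib)
  qed simp
  also have "\<dots> = contour_integral (circlepath 0 1) (\<lambda>t. f t / (t - z))
      + contour_integral (circlepath 0 1) (\<lambda>t. f t / (w - t)) - f \<zeta> * (2 * of_real pi * \<i>)"
    using int by (simp add: contour_integral_diff contour_integral_add contour_integrable_diff contour_integrable_add c1 c2)
  finally have eq: "contour_integral (circlepath 0 1) (\<lambda>t. (f t - f \<zeta>) * k t) = \<dots>" .
  have "norm (contour_integral (circlepath 0 1) (\<lambda>t. (f t - f \<zeta>) * k t))
      \<le> 2 * pi * (16 * C * (1 - r\<^sup>2)) / (1 - \<alpha>) * (1 - r) powr (\<alpha> - 1)"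
    by (rule holder_kernel_bound[OF \<alpha> C hol \<zeta> _ r(2) kcont])
      (use r knorm in \<open>auto simp: power_le_one\<close>)
  \<comment> \<open>The Poisson numerator \<open>1 - r\<^sup>2\<close> supplies a factor
    \<open>1 - r\<close>, which turns a power that grows as \<open>r\<close> tends to 1 into one
    that tends to 0.\<close>
  also have "\<dots> \<le> 2 * pi * (16 * C * (2 * (1 - r))) / (1 - \<alpha>) * (1 - r) powr (\<alpha> - 1)"
  proof -
    have "1 - r\<^sup>2 = (1 + r) * (1 - r)" by (simp add: power2_eq_square algebra_simps)
    also have "\<dots> \<le> 2 * (1 - r)" using r by (intro mult_right_mono) auto
    finally show ?thesis
      using C \<alpha> by (intro mult_right_mono divide_right_mono mult_left_mono) auto
  qed
  also have "\<dots> = 2 * pi * (32 * C / (1 - \<alpha>) * ((1 - r) * (1 - r) powr (\<alpha> - 1)))" by simp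
  also have "(1 - r) * (1 - r) powr (\<alpha> - 1) = (1 - r) powr \<alpha>"
    using r by (simp add: powr_diff)
  finally have "norm (contour_integral (circlepath 0 1) (\<lambda>t. (f t - f \<zeta>) * k t)) / (2 * pi)
      \<le> 32 * C / (1 - \<alpha>) * (1 - r) powr \<alpha>"
    by (simp only: pos_divide_le_eq mult_ac pi_gt_zero zero_less_mult_iff zero_less_numeral simp_thms)
  moreover have "norm (X / (2 * of_real pi * \<i>)) = norm X / (2 * pi)" for X :: complex
    by (simp add: norm_mult norm_divide)
  ultimately have "norm (contour_integral (circlepath 0 1) (\<lambda>t. (f t - f \<zeta>) * k t) / (2 * of_real pi * \<i>))
      \<le> 32 * C / (1 - \<alpha>) * (1 - r) powr \<alpha>"
    by (simp only:)
  also have "contour_integral (circlepath 0 1) (\<lambda>t. (f t - f \<zeta>) * k t) / (2 * of_real pi * \<i>) =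
      cauchy_circle f z + anti_analytic_part f w - f \<zeta>"
    unfolding eq by (simp add: cauchy_circle_def anti_analytic_part_def add_divide_distrib diff_divide_distrib)
  finally show ?thesis unfolding z_def w_eq .
qed

text \<open>Distances on the circle are at most 2, so lowering the exponent costs a factor
  \<open>2 powr (\<alpha> - \<beta>)\<close>. This brings exponents \<alpha> \<ge> 1 into the range
  of the kernel estimates.\<close>

lemma holder_on_bounded_exponent_mono:
  fixes f :: "complex \<Rightarrow> complex"
  assumes "holder_on \<alpha> unit_circle f" "\<beta> \<le> \<alpha>"
  obtains C where "C \<ge> 0" "\<And>x y. x \<in> unit_circle \<Longrightarrow> y \<in> unit_circle \<Longrightarrow> dist (f x) (f y) \<le> C * dist x y powr \<beta>"
proof -
  obtain C where C: "\<And>x y. x \<in> unit_circle \<Longrightarrow> y \<in> unit_circle \<Longrightarrow> dist (f x) (f y) \<le> C * dist x y powr \<alpha>"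
    using assms unfolding holder_on_def by blast
  show thesis
  proof (rule that)
    show "\<bar>C\<bar> * 2 powr (\<alpha> - \<beta>) \<ge> 0" by simp
    fix x y :: complex assume xy: "x \<in> unit_circle" "y \<in> unit_circle"
    have "dist x y \<le> norm x + norm y" by (simp add: dist_norm norm_triangle_ineq4)
    then have d: "dist x y \<le> 2" using xy by simp
    have "dist x y powr \<alpha> = dist x y powr (\<alpha> - \<beta>) * dist x y powr \<beta>"
      by (simp add: powr_add[symmetric])
    also have "\<dots> \<le> 2 powr (\<alpha> - \<beta>) * dist x y powr \<beta>"
      using d assms(2) by (intro mult_right_mono powr_mono2) auto
    finally have "dist x y powr \<alpha> \<le> 2 powr (\<alpha> - \<beta>) * dist x y powr \<beta>" .
    then have "\<bar>C\<bar> * dist x y powr \<alpha> \<le> \<bar>C\<bar> * (2 powr (\<alpha> - \<beta>) * dist x y powr \<beta>)"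
      by (rule mult_left_mono) simp
    moreover have "C * dist x y powr \<alpha> \<le> \<bar>C\<bar> * dist x y powr \<alpha>" by (intro mult_right_mono) auto
    ultimately show "dist (f x) (f y) \<le> \<bar>C\<bar> * 2 powr (\<alpha> - \<beta>) * dist x y powr \<beta>"
      using C[OF xy] by (simp add: mult.assoc)
  qed
qed

lemma cauchy_circle_extension:
  assumes \<alpha>: "0 < \<alpha>" "\<alpha> < 1" and C: "C \<ge> 0"
    and hol: "\<And>x y. x \<in> unit_circle \<Longrightarrow> y \<in> unit_circle \<Longrightarrow> dist (F x) (F y) \<le> C * dist x y powr \<alpha>"
  obtains \<Phi> where "\<Phi> \<in> disk_algebra" "holder_on \<alpha> (cball 0 1) \<Phi>"
    "\<And>z. norm z < 1 \<Longrightarrow> \<Phi> z = cauchy_circle F z"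
proof -
  have cont: "continuous_on unit_circle F"
    using holder_on_imp_continuous_on[of \<alpha> unit_circle F] \<alpha> hol unfolding holder_on_def by blast
  define B where "B = 16 * C / (1 - \<alpha>)"
  have B: "B \<ge> 0" using C \<alpha> by (simp add: B_def)
  show thesis
  proof (rule disk_algebra_extension[of \<alpha> "(2 / \<alpha> + 2) * B" "cauchy_circle F"])
    show "cauchy_circle F holomorphic_on unit_disk"
      by (rule holomorphic_onI)
        (use cauchy_circle_has_field_derivative[OF cont] field_differentiable_def field_differentiable_at_within in \<open>simp, blast\<close>)
    show "dist (cauchy_circle F z) (cauchy_circle F w) \<le> (2 / \<alpha> + 2) * B * dist z w powr \<alpha>"
      if "norm z < 1" "norm w < 1" for z w
      by (rule holder_of_deriv_bound[OF \<alpha> B cauchy_circle_has_field_derivative[OF cont] _ that])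
        (use cauchy_circle_deriv_bound[OF \<alpha> C hol] B_def in auto)
  qed (use \<alpha> B that in auto)
qed

section \<open>The disk algebra and the splitting of a Hoelder function\<close>

lemma disk_algebra_add: "g \<in> disk_algebra \<Longrightarrow> h \<in> disk_algebra \<Longrightarrow> (\<lambda>z. g z + h z) \<in> disk_algebra"
  by (auto simp: disk_algebra_def intro!: continuous_intros holomorphic_intros)

lemma disk_algebra_diff: "g \<in> disk_algebra \<Longrightarrow> h \<in> disk_algebra \<Longrightarrow> (\<lambda>z. g z - h z) \<in> disk_algebra"
  by (auto simp: disk_algebra_def intro!: continuous_intros holomorphic_intros)

lemma disk_algebra_mult: "g \<in> disk_algebra \<Longrightarrow> h \<in> disk_algebra \<Longrightarrow> (\<lambda>z. g z * h z) \<in> disk_algebra"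
  by (auto simp: disk_algebra_def intro!: continuous_intros holomorphic_intros)

lemma disk_algebra_poly: "poly p \<in> disk_algebra"
  by (auto simp: disk_algebra_def intro!: continuous_intros holomorphic_intros)

text \<open>Both Cauchy integrals extend continuously to the circle, so the splitting follows from
  \<open>plemelj_bound\<close> as the radius tends to 1.\<close>

lemma holder_decomposition:
  assumes "\<alpha> > 1/2" "holder_on \<alpha> unit_circle f"
  obtains \<Psi> \<Phi> \<beta> where "\<Psi> \<in> disk_algebra" "\<Phi> \<in> disk_algebra" "1/2 < \<beta>" "\<beta> < 1" "holder_on \<beta> unit_circle \<Phi>"
    "\<And>t. t \<in> unit_circle \<Longrightarrow> f t = \<Psi> t + \<Phi> (cnj t)"
    "\<Phi> 0 = 0" "\<And>z. z \<noteq> 0 \<Longrightarrow> norm z < 1 \<Longrightarrow> anti_analytic_part f (1 / z) = \<Phi> z"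
proof -
  \<comment> \<open>Above 1/2 for the null set argument, and below 1 for the kernel estimates, which
    divide by \<open>1 - \<beta>\<close>.\<close>
  define \<beta> where "\<beta> = min \<alpha> (3/4)"
  have \<beta>: "1/2 < \<beta>" "\<beta> < 1" "0 < \<beta>" "\<beta> \<le> \<alpha>" using assms by (auto simp: \<beta>_def)
  obtain C where C: "C \<ge> 0" "\<And>x y. x \<in> unit_circle \<Longrightarrow> y \<in> unit_circle \<Longrightarrow> dist (f x) (f y) \<le> C * dist x y powr \<beta>"
    using holder_on_bounded_exponent_mono[OF assms(2) \<beta>(4)] by blast
  have cont: "continuous_on unit_circle f"
    using holder_on_imp_continuous_on[of \<alpha> unit_circle f] assms by simp
  have Ccnj: "dist ((f \<circ> cnj) x) ((f \<circ> cnj) y) \<le> C * dist x y powr \<beta>" if "x \<in> unit_circle" "y \<in> unit_circle" for x y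
  proof -
    have "dist (cnj x) (cnj y) = dist x y"
      by (metis complex_cnj_diff complex_mod_cnj dist_norm)
    then show ?thesis using C(2)[of "cnj x" "cnj y"] that by simp
  qed
  obtain \<Psi> where \<Psi>: "\<Psi> \<in> disk_algebra" "\<And>z. norm z < 1 \<Longrightarrow> \<Psi> z = cauchy_circle f z"
    using cauchy_circle_extension[OF \<beta>(3,2) C] by blast
  obtain \<Phi>0 where \<Phi>0: "\<Phi>0 \<in> disk_algebra" "holder_on \<beta> (cball 0 1) \<Phi>0"
      "\<And>z. norm z < 1 \<Longrightarrow> \<Phi>0 z = cauchy_circle (f \<circ> cnj) z"
    using cauchy_circle_extension[OF \<beta>(3,2) C(1) Ccnj] by blast
  \<comment> \<open>The constant subtracted is the one in \<open>anti_analytic_part_inverse\<close>,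
    and it gives \<open>\<Phi> 0 = 0\<close>.\<close>
  define \<Phi> where "\<Phi> = (\<lambda>z. \<Phi>0 z - \<Phi>0 0)"
  have \<Phi>_anti: "anti_analytic_part f (1 / z) = \<Phi> z" if "z \<noteq> 0" "norm z < 1" for z
    using anti_analytic_part_inverse[OF cont that] \<Phi>0(3) that by (simp add: \<Phi>_def)
  have \<Phi>_da: "\<Phi> \<in> disk_algebra"
    using \<Phi>0(1) unfolding \<Phi>_def disk_algebra_def by (auto intro!: continuous_intros holomorphic_intros)
  have "f t = \<Psi> t + \<Phi> (cnj t)" if t: "t \<in> unit_circle" for t
  proof -
    \<comment> \<open>Two successors keep \<open>r n\<close> positive: \<open>\<Phi>\<close> is
      identified with the anti-analytic part only away from the origin.\<close>
    define r where "r = (\<lambda>n. 1 - inverse (real (Suc (Suc n))))"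
    have r: "0 < r n" "r n < 1" for n
      unfolding r_def by (simp_all add: field_simps)
    have rlim: "r \<longlonglongrightarrow> 1 - 0"
      unfolding r_def by (intro tendsto_intros LIMSEQ_Suc[OF LIMSEQ_inverse_real_of_nat])
    then have r1: "(\<lambda>n. complex_of_real (r n)) \<longlonglongrightarrow> of_real 1" by (intro tendsto_of_real) simp
    have lim: "(\<lambda>n. G (of_real (r n) * s)) \<longlonglongrightarrow> G s" if "G \<in> disk_algebra" "norm s = 1" for G s
    proof (rule continuous_on_tendsto_compose[of "cball 0 1" G])
      show "continuous_on (cball 0 1) G" using that by (simp add: disk_algebra_def)
      show "(\<lambda>n. of_real (r n) * s) \<longlonglongrightarrow> s"
        using tendsto_mult_right[OF r1, of s] by simp
      show "\<forall>\<^sub>F n in sequentially. of_real (r n) * s \<in> cball 0 1"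
        using r that by (auto simp: norm_mult less_imp_le abs_of_pos intro!: always_eventually)
    qed (use that in auto)
    have "(\<lambda>n. norm (\<Psi> (of_real (r n) * t) + \<Phi> (of_real (r n) * cnj t) - f t)) \<longlonglongrightarrow> norm (\<Psi> t + \<Phi> (cnj t) - f t)"
      using t by (intro tendsto_intros lim \<Psi>(1) \<Phi>_da) auto
    moreover have "(\<lambda>n. 32 * C / (1 - \<beta>) * (1 - r n) powr \<beta>) \<longlonglongrightarrow> 32 * C / (1 - \<beta>) * (1 - (1 - 0)) powr \<beta>"
      using r \<beta> by (intro tendsto_intros tendsto_powr2 rlim always_eventually) (auto simp: less_imp_le)
    ultimately have "norm (\<Psi> t + \<Phi> (cnj t) - f t) \<le> 32 * C / (1 - \<beta>) * (1 - (1 - 0)) powr \<beta>"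
    proof (rule LIMSEQ_le, intro exI allI impI)
      fix n
      have n: "norm (of_real (r n) * s) < 1" "of_real (r n) * s \<noteq> 0" if "norm s = 1" for s :: complex
        using r[of n] that by (auto simp: norm_mult)
      show "norm (\<Psi> (of_real (r n) * t) + \<Phi> (of_real (r n) * cnj t) - f t) \<le> 32 * C / (1 - \<beta>) * (1 - r n) powr \<beta>"
        using plemelj_bound[OF \<beta>(3,2) C _ r[of n], of t] t n[of t] n[of "cnj t"] \<Psi>(2) \<Phi>_anti[of "of_real (r n) * cnj t"]
        by simp
    qed
    then show ?thesis by simp
  qed
  moreover have "holder_on \<beta> unit_circle \<Phi>"
  proof -
    obtain D where D: "\<forall>x\<in>cball 0 1. \<forall>y\<in>cball 0 1. dist (\<Phi>0 x) (\<Phi>0 y) \<le> D * dist x y powr \<beta>"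
      using \<Phi>0(2) unfolding holder_on_def by blast
    have "dist (\<Phi> x) (\<Phi> y) = dist (\<Phi>0 x) (\<Phi>0 y)" for x y by (simp add: \<Phi>_def dist_norm)
    then show ?thesis using D unfolding holder_on_def by (intro exI[of _ D]) auto
  qed
  ultimately show thesis
    using that[OF \<Psi>(1) \<Phi>_da \<beta>(1,2)] \<Phi>_anti by (simp add: \<Phi>_def)
qed

section \<open>Zeros and winding numbers\<close>

text \<open>The Taylor series of \<open>h\<close> may fail to converge uniformly up to the circle.
  That of the dilation \<open>h (r * z)\<close> does converge uniformly, and the dilation is
  uniformly close to \<open>h\<close> for \<open>r\<close> near 1.\<close>

lemma disk_algebra_poly_approx:
  assumes "h \<in> disk_algebra" "e > 0"
  obtains q :: "complex poly" where "\<And>z. z \<in> cball 0 1 \<Longrightarrow> norm (poly q z - h z) < e"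
proof -
  have cont: "continuous_on (cball 0 1) h" and holo: "h holomorphic_on unit_disk"
    using assms(1) by (simp_all add: disk_algebra_def)
  have "uniformly_continuous_on (cball 0 1) h"
    using cont by (simp add: compact_uniformly_continuous)
  then obtain d where d: "d > 0"
      "\<And>x y. \<lbrakk>x \<in> cball 0 1; y \<in> cball 0 1; dist x y < d\<rbrakk> \<Longrightarrow> dist (h x) (h y) < e / 2"
    using assms(2) unfolding uniformly_continuous_on_def by (metis half_gt_zero)
  define r where "r = max (1/2) (1 - d/2)"
  have r: "0 < r" "r < 1" "1 - r < d" using d(1) by (auto simp: r_def max_def)
  define a where "a = (\<lambda>n. (deriv ^^ n) h 0 / fact n)"
  have sums: "(\<lambda>n. a n * w ^ n) sums h w" if "w \<in> ball 0 1" for w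
    using holomorphic_power_series[OF holo that] by (simp add: a_def)
  \<comment> \<open>An intermediate radius shows that the radius of convergence is strictly larger
    than \<open>r\<close>, as uniform convergence on \<open>cball 0 r\<close> requires.\<close>
  define r' where "r' = (1 + r) / 2"
  have r': "r < r'" "r' < 1" using r by (auto simp: r'_def)
  have "summable (\<lambda>n. a n * of_real r' ^ n)"
    using sums[of "of_real r'"] r r' by (auto simp: sums_iff)
  then have "conv_radius a \<ge> norm (complex_of_real r')" by (rule conv_radius_geI)
  then have "ereal r < conv_radius a"
    using r r' by (simp add: less_le_trans[of "ereal r" "ereal r'"])
  from powser_uniform_limit[OF this, of 0]
  have "uniform_limit (cball 0 r) (\<lambda>n x. \<Sum>i<n. a i * x ^ i) (\<lambda>x. \<Sum>i. a i * x ^ i) sequentially" by simp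
  then have "\<forall>\<^sub>F n in sequentially. \<forall>x\<in>cball 0 r. dist (\<Sum>i<n. a i * x ^ i) (\<Sum>i. a i * x ^ i) < e / 2"
    using assms(2) by (intro uniform_limitD) auto
  then obtain n where n: "\<And>x. x \<in> cball 0 r \<Longrightarrow> dist (\<Sum>i<n. a i * x ^ i) (\<Sum>i. a i * x ^ i) < e / 2"
    by (blast dest: eventually_happens'[OF sequentially_bot])
  define q where "q = (\<Sum>i<n. monom (a i * of_real r ^ i) i)"
  show thesis
  proof
    fix z :: complex assume z: "z \<in> cball 0 1"
    have rz: "norm (of_real r * z) \<le> r" using z r by (simp add: norm_mult)
    have "poly q z = (\<Sum>i<n. a i * (of_real r * z) ^ i)"
      by (simp add: q_def poly_sum poly_monom power_mult_distrib mult.assoc)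
    moreover have "(\<Sum>i. a i * (of_real r * z) ^ i) = h (of_real r * z)"
      using sums[of "of_real r * z"] rz r by (simp add: sums_iff)
    ultimately have 1: "dist (poly q z) (h (of_real r * z)) < e / 2"
      using n[of "of_real r * z"] rz by simp
    have "dist (of_real r * z) z = norm (of_real (r - 1) * z)"
      by (simp add: dist_norm algebra_simps)
    also have "\<dots> = (1 - r) * norm z" using r by (simp add: norm_mult del: of_real_diff)
    also have "\<dots> \<le> (1 - r) * 1" using z r by (intro mult_left_mono) auto
    finally have "dist (h (of_real r * z)) (h z) < e / 2"
      using rz r z by (intro d(2)) auto
    with 1 have "dist (poly q z) (h z) < e"
      using dist_triangle_half_l dist_commute by metis
    then show "norm (poly q z - h z) < e" by (simp add: dist_norm)
  qed
qed

section \<open>Hoelder functions under sums, products and polynomials\<close>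

lemma holder_on_add:
  fixes f g :: "'a::metric_space \<Rightarrow> 'b::real_normed_vector"
  assumes "holder_on \<beta> S f" "holder_on \<beta> S g"
  shows "holder_on \<beta> S (\<lambda>x. f x + g x)"
proof -
  obtain C D where C: "\<And>x y. x \<in> S \<Longrightarrow> y \<in> S \<Longrightarrow> dist (f x) (f y) \<le> C * dist x y powr \<beta>"
    and D: "\<And>x y. x \<in> S \<Longrightarrow> y \<in> S \<Longrightarrow> dist (g x) (g y) \<le> D * dist x y powr \<beta>"
    using assms unfolding holder_on_def by blast
  have "dist (f x + g x) (f y + g y) \<le> (C + D) * dist x y powr \<beta>" if "x \<in> S" "y \<in> S" for x y
    using dist_triangle_add[of "f x" "g x" "f y" "g y"] C[OF that] D[OF that] by (simp add: distrib_right)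
  then show ?thesis unfolding holder_on_def by blast
qed

lemma holder_on_mult:
  fixes f g :: "'a::metric_space \<Rightarrow> 'b::real_normed_algebra"
  assumes "holder_on \<beta> S f" "holder_on \<beta> S g" "bounded (f ` S)" "bounded (g ` S)"
  shows "holder_on \<beta> S (\<lambda>x. f x * g x)"
proof -
  obtain C D where C: "\<And>x y. x \<in> S \<Longrightarrow> y \<in> S \<Longrightarrow> dist (f x) (f y) \<le> C * dist x y powr \<beta>"
    and D: "\<And>x y. x \<in> S \<Longrightarrow> y \<in> S \<Longrightarrow> dist (g x) (g y) \<le> D * dist x y powr \<beta>"
    using assms unfolding holder_on_def by blast
  obtain A B where A: "\<And>x. x \<in> S \<Longrightarrow> norm (f x) \<le> A" "A > 0" and B: "\<And>x. x \<in> S \<Longrightarrow> norm (g x) \<le> B" "B > 0"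
    using assms(3,4) unfolding bounded_pos by auto
  have "dist (f x * g x) (f y * g y) \<le> (A * D + C * B) * dist x y powr \<beta>" if xy: "x \<in> S" "y \<in> S" for x y
  proof -
    have "f x * g x - f y * g y = f x * (g x - g y) + (f x - f y) * g y" by (simp add: algebra_simps)
    then have "dist (f x * g x) (f y * g y) \<le> norm (f x * (g x - g y)) + norm ((f x - f y) * g y)"
      by (simp add: dist_norm norm_triangle_ineq)
    also have "\<dots> \<le> norm (f x) * dist (g x) (g y) + dist (f x) (f y) * norm (g y)"
      by (simp add: dist_norm norm_mult_ineq add_mono)
    also have "\<dots> \<le> A * (D * dist x y powr \<beta>) + (C * dist x y powr \<beta>) * B"
      using A B C[OF xy] D[OF xy] xy
      by (intro add_mono mult_mono order_trans[OF zero_le_dist C[OF xy]]) auto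
    finally show ?thesis by (simp add: algebra_simps)
  qed
  then show ?thesis unfolding holder_on_def by blast
qed

lemma holder_on_circle_poly:
  fixes p :: "complex poly"
  assumes "0 < \<beta>" "\<beta> \<le> 1"
  shows "holder_on \<beta> unit_circle (poly p)"
proof (induction p)
  case 0
  then show ?case by (auto simp: holder_on_def intro!: exI[of _ 0])
next
  case (pCons a p)
  have const: "holder_on \<beta> unit_circle (\<lambda>_. a)"
    by (auto simp: holder_on_def intro!: exI[of _ 0])
  have "holder_on 1 unit_circle (\<lambda>z::complex. z)"
    by (auto simp: holder_on_def intro!: exI[of _ 1])
  then have id: "holder_on \<beta> unit_circle (\<lambda>z::complex. z)"
    using holder_on_bounded_exponent_mono[of 1 "\<lambda>z. z" \<beta>] assms unfolding holder_on_def by metis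
  have "bounded ((\<lambda>z. z) ` unit_circle)" "bounded (poly p ` unit_circle)"
    by (auto intro!: compact_imp_bounded compact_continuous_image continuous_intros)
  then show ?case
    using holder_on_add[OF const holder_on_mult[OF id pCons.IH]] by (simp add: pCons)
qed

section \<open>Counting zeros and reversing polynomials\<close>

lemma disk_zeros_cong:
  assumes "\<And>z. z \<in> unit_disk \<Longrightarrow> g z = h z"
  shows "disk_zeros g = disk_zeros h"
proof -
  have "{z \<in> unit_disk. g z = 0} = {z \<in> unit_disk. h z = 0}" using assms by auto
  moreover have "zorder g z = zorder h z" if "z \<in> unit_disk" for z
  proof (rule zorder_cong)
    have "\<forall>\<^sub>F w in nhds z. w \<in> unit_disk"
      using that by (intro eventually_nhds_in_open) auto
    then show "\<forall>\<^sub>F w in at z. g w = h w"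
      unfolding eventually_at_filter by eventually_elim (use assms in auto)
  qed simp
  ultimately show ?thesis unfolding disk_zeros_def Let_def by (auto intro: sum.cong)
qed

lemma reversed_poly:
  fixes p :: "'a::field poly"
  assumes "degree p \<le> n"
  obtains q where "degree q \<le> n" "\<And>x. x \<noteq> 0 \<Longrightarrow> poly q x = x ^ n * poly p (inverse x)"
proof
  \<comment> \<open>\<open>reflect_poly\<close> reverses with respect to the actual degree; the
    monomial makes up the difference to \<open>n\<close>.\<close>
  let ?q = "reflect_poly p * monom 1 (n - degree p)"
  have "degree ?q \<le> degree (reflect_poly p) + degree (monom (1::'a) (n - degree p))"
    by (rule degree_mult_le)
  also have "\<dots> \<le> n" using assms degree_reflect_poly_le[of p] by (simp add: degree_monom_eq)
  finally show "degree ?q \<le> n" .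
  show "poly ?q x = x ^ n * poly p (inverse x)" if "x \<noteq> 0" for x
    using that assms by (simp add: poly_reflect_poly_nz poly_monom power_add[symmetric] mult_ac)
qed

lemma circle_mult_cnj_power: "norm (t::complex) = 1 \<Longrightarrow> t ^ n * cnj t ^ n = 1"
  by (simp add: power_mult_distrib[symmetric] complex_norm_square[symmetric])

lemma circle_inverse: "norm (t::complex) = 1 \<Longrightarrow> inverse t = cnj t"
  using divide_conv_cnj[of t 1] by (simp add: divide_inverse)

text \<open>The zeros may be infinite in number and accumulate at the circle, whereas a finite set
  of them fits into a smaller disk. In the infinite case \<open>N + 1\<close> zeros suffice, since
  each has order at least 1.\<close>

lemma finite_subset_disk_zeros_gt:
  assumes "g holomorphic_on unit_disk" "z0 \<in> unit_disk" "g z0 \<noteq> 0" "\<not> disk_zeros g \<le> enat N"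
  obtains S where "finite S" "S \<subseteq> {z \<in> unit_disk. g z = 0}" "int N < (\<Sum>z\<in>S. zorder g z)"
proof -
  have pos: "zorder g z > 0" if "z \<in> {z \<in> unit_disk. g z = 0}" for z
    using zorder_zero_pos[OF assms(1-3)] that by blast
  show thesis
  proof (cases "finite {z \<in> unit_disk. g z = 0}")
    case True
    have "int (\<Sum>z \<in> {z \<in> unit_disk. g z = 0}. nat (zorder g z)) = (\<Sum>z \<in> {z \<in> unit_disk. g z = 0}. zorder g z)"
      unfolding of_nat_sum by (rule sum.cong) (use pos in \<open>auto simp: less_imp_le\<close>)
    moreover have "N < (\<Sum>z \<in> {z \<in> unit_disk. g z = 0}. nat (zorder g z))"
      using assms(4) True by (simp add: disk_zeros_def)
    ultimately show ?thesis using that[OF True order_refl] by linarith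
  next
    case False
    then obtain S where S: "finite S" "card S = Suc N" "S \<subseteq> {z \<in> unit_disk. g z = 0}"
      using infinite_arbitrarily_large by blast
    have "(\<Sum>z\<in>S. 1) \<le> (\<Sum>z\<in>S. zorder g z)"
      using pos S(3) by (intro sum_mono) force
    then show ?thesis using that[OF S(1,3)] S(2) by simp
  qed
qed

text \<open>Too many zeros of \<open>g\<close> are already enclosed by a smaller circle free of
  zeros. Subtracting a small \<open>w\<close> that \<open>g\<close> omits on the unit circle
  preserves the count there and leaves no zeros on the unit circle. The argument principle on the
  unit circle then contradicts \<open>wind\<close>.\<close>

lemma disk_zeros_le_of_winding_ge:
  assumes \<Phi>: "\<Phi> \<in> disk_algebra" and \<beta>: "1/2 < \<beta>" "\<beta> < 1" and hol: "holder_on \<beta> unit_circle \<Phi>"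
    and wind: "\<And>h. h \<in> disk_algebra \<Longrightarrow> (\<And>t. t \<in> unit_circle \<Longrightarrow> \<Phi> (cnj t) + h t \<noteq> 0) \<Longrightarrow>
      circle_winding (\<lambda>t. \<Phi> (cnj t) + h t) \<ge> - real m"
    and nontriv: "\<And>h. h \<in> disk_algebra \<Longrightarrow> \<exists>t\<in>unit_circle. \<Phi> (cnj t) + h t \<noteq> 0"
    and p: "degree p \<le> n"
  shows "disk_zeros (\<lambda>z. z ^ n * \<Phi> z + poly p z) \<le> enat (m + n)"
proof (rule ccontr)
  define g where "g = (\<lambda>z. z ^ n * \<Phi> z + poly p z)"
  assume "\<not> disk_zeros (\<lambda>z. z ^ n * \<Phi> z + poly p z) \<le> enat (m + n)"
  then have many: "\<not> disk_zeros g \<le> enat (m + n)" by (simp add: g_def)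
  have monom: "(\<lambda>z. z ^ n) \<in> disk_algebra"
    using disk_algebra_poly[of "monom 1 n"] by (simp add: poly_monom[abs_def])
  have gA: "g \<in> disk_algebra"
    unfolding g_def by (intro disk_algebra_add disk_algebra_mult monom \<Phi> disk_algebra_poly)
  then have gcont: "continuous_on (cball 0 1) g" and gholo: "g holomorphic_on unit_disk"
    by (simp_all add: disk_algebra_def)
  obtain q where q: "\<And>x. x \<noteq> 0 \<Longrightarrow> poly q x = x ^ n * poly p (inverse x)"
    using reversed_poly[OF p] by blast
  \<comment> \<open>A constant \<open>c\<close> added to \<open>g\<close> becomes
    \<open>c * t ^ n\<close> after reflection, which is again in the disk algebra. This is why
    constants are admissible perturbations.\<close>
  have reflected: "t ^ n * (g (cnj t) + c) = \<Phi> (cnj t) + (poly q t + c * t ^ n)" if "t \<in> unit_circle" for t c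
  proof -
    have t: "norm t = 1" "t \<noteq> 0" using that by auto
    have "t ^ n * (g (cnj t) + c) = (t ^ n * cnj t ^ n) * \<Phi> (cnj t) + (t ^ n * poly p (cnj t) + c * t ^ n)"
      by (simp add: g_def algebra_simps)
    then show ?thesis using t by (simp add: circle_mult_cnj_power q circle_inverse)
  qed
  \<comment> \<open>If \<open>g\<close> vanished identically, so would
    \<open>\<Phi> (cnj t) + poly q t\<close> on the circle, which \<open>nontriv\<close> forbids.
    Here it matters that \<open>f\<close> does not come from the disk algebra.\<close>
  obtain z0 where z0: "z0 \<in> unit_disk" "g z0 \<noteq> 0"
  proof (rule ccontr)
    assume "\<not> thesis"
    then have "\<And>z. z \<in> unit_disk \<Longrightarrow> g z = 0" using that by blast
    then have 0: "g z = 0" if "z \<in> cball 0 1" for z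
      using continuous_constant_on_closure[of unit_disk g 0 z] gcont that by simp
    obtain t where t: "t \<in> unit_circle" "\<Phi> (cnj t) + poly q t \<noteq> 0"
      using nontriv[OF disk_algebra_poly] by blast
    then show False using reflected[of t 0] 0[of "cnj t"] by simp
  qed
  obtain S where S: "finite S" "S \<subseteq> {z \<in> unit_disk. g z = 0}" "int (m + n) < (\<Sum>z\<in>S. zorder g z)"
    by (rule finite_subset_disk_zeros_gt[OF gholo z0 many])
  \<comment> \<open>Inserting 0 makes the set nonempty and the maximum nonnegative.\<close>
  define r1 where "r1 = Max (insert 0 (norm ` S))"
  have r1: "0 \<le> r1" "r1 < 1" "\<And>z. z \<in> S \<Longrightarrow> norm z \<le> r1"
    using S(1,2) by (auto simp: r1_def)
  define r2 where "r2 = (1 + r1) / 2"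
  have r2: "r1 < r2" "r2 < 1" using r1 by (auto simp: r2_def)
  have "finite (norm ` {z \<in> cball 0 r2. g z = 0})"
    by (intro finite_imageI finite_zeros_ball[OF gholo r2(2) z0])
  \<comment> \<open>Only finitely many radii are taken by zeros, so some circle between
    \<open>r1\<close> and \<open>r2\<close> avoids all of them and still encloses
    \<open>S\<close>.\<close>
  then have "infinite ({r1<..<r2} - norm ` {z \<in> cball 0 r2. g z = 0})"
    using infinite_Ioo[OF r2(1)] by (rule Diff_infinite_finite)
  then obtain r where "r \<in> {r1<..<r2} - norm ` {z \<in> cball 0 r2. g z = 0}"
    using not_finite_existsD by (metis ex_in_conv finite.emptyI)
  then have r: "r1 < r" "r < r2" "\<And>z. norm z = r \<Longrightarrow> g z \<noteq> 0" by auto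
  have r01: "0 < r" "r < 1" using r1 r2 r by auto
  have W_r: "circle_winding (\<lambda>t. g (of_real r * t)) = of_int (\<Sum>z | z \<in> ball 0 r \<and> g z = 0. zorder g z)"
    by (rule circle_winding_eq_sum_zorder[OF gholo r01 r(3)])
  have "(\<Sum>z\<in>S. zorder g z) \<le> (\<Sum>z | z \<in> ball 0 r \<and> g z = 0. zorder g z)"
  proof (rule sum_mono2)
    show "finite {z. z \<in> ball 0 r \<and> g z = 0}"
      by (rule finite_subset[OF _ finite_zeros_ball[OF gholo r01(2) z0]]) auto
    show "S \<subseteq> {z. z \<in> ball 0 r \<and> g z = 0}" using S(2) r1(3) r(1) by force
  next
    fix z assume "z \<in> {z. z \<in> ball 0 r \<and> g z = 0} - S"
    then have "z \<in> unit_disk" "g z = 0" using r01 by auto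
    then show "0 \<le> zorder g z" using zorder_zero_pos[OF gholo z0] by (simp add: less_imp_le)
  qed
  then have W_r_gt: "circle_winding (\<lambda>t. g (of_real r * t)) > real (m + n)"
    using S(3) unfolding W_r by linarith
  have "continuous_on (sphere 0 r) g" by (rule continuous_on_subset[OF gcont]) (use r01 in auto)
  moreover have "\<And>z. z \<in> sphere 0 r \<Longrightarrow> g z \<noteq> 0" using r(3) by simp
  ultimately obtain e where e: "e > 0" "\<And>z. z \<in> sphere 0 r \<Longrightarrow> e \<le> norm (g z)"
    using norm_bounded_away_from_0[OF compact_sphere] by blast
  have "holder_on \<beta> unit_circle g"
  proof -
    have bdd: "bounded (f ` unit_circle)" if "f \<in> disk_algebra" for f
      using that unfolding disk_algebra_def
      by (auto intro!: compact_imp_bounded compact_continuous_image elim: continuous_on_subset)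
    have "holder_on \<beta> unit_circle (poly (monom 1 n))" by (rule holder_on_circle_poly) (use \<beta> in auto)
    then have "holder_on \<beta> unit_circle (\<lambda>z. z ^ n)" by (simp add: poly_monom[abs_def])
    then show ?thesis
      unfolding g_def using \<beta>
      by (intro holder_on_add holder_on_mult holder_on_circle_poly hol bdd monom \<Phi>) auto
  qed
  then have "negligible (g ` unit_circle)" by (rule negligible_image_circle_holder[OF \<beta>(1)])
  \<comment> \<open>A disk has positive area, so the null set \<open>g\<close> takes on the circle
    cannot cover it, however small \<open>e\<close> is.\<close>
  moreover have "\<not> negligible (ball (0::complex) e)"
    using e(1) by (intro open_not_negligible) auto
  ultimately obtain w where w: "w \<in> ball 0 e" "w \<notin> g ` unit_circle"
    using negligible_subset by blast
  define G where "G = (\<lambda>z. g z + (- w))"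
  have GA: "G \<in> disk_algebra"
    using disk_algebra_add[OF gA disk_algebra_poly[of "[:- w:]"]] by (simp add: G_def)
  then have Gcont: "continuous_on (cball 0 1) G" and Gholo: "G holomorphic_on unit_disk"
    by (simp_all add: disk_algebra_def)
  have Gnz: "G t \<noteq> 0" if "t \<in> unit_circle" for t using w(2) that by (auto simp: G_def)
  have Gnz_r: "G z \<noteq> 0" if "norm z = r" for z
    using e(2)[of z] that w(1) by (auto simp: G_def)
  have rcont: "continuous_on unit_circle (\<lambda>t. f (of_real r * t))" if "continuous_on (cball 0 1) f" for f :: "complex \<Rightarrow> complex"
    by (intro continuous_on_compose2[OF that] continuous_intros) (use r01 in \<open>auto simp: norm_mult\<close>)
  have "circle_winding (\<lambda>t. G (of_real r * t)) = circle_winding (\<lambda>t. g (of_real r * t))"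
  proof (rule circle_winding_nearby)
    fix t :: complex assume "t \<in> unit_circle"
    then have "of_real r * t \<in> sphere 0 r" using r01 by (simp add: norm_mult)
    from e(2)[OF this] show "norm (G (of_real r * t) - g (of_real r * t)) < norm (g (of_real r * t))"
      using w(1) by (simp add: G_def)
  qed (use rcont gcont Gcont in auto)
  also have "circle_winding (\<lambda>t. G (of_real r * t)) = of_int (\<Sum>z | z \<in> ball 0 r \<and> G z = 0. zorder G z)"
    by (rule circle_winding_eq_sum_zorder[OF Gholo r01 Gnz_r])
  finally have "circle_winding (\<lambda>t. g (of_real r * t)) = of_int (\<Sum>z | z \<in> ball 0 r \<and> G z = 0. zorder G z)" ..
  \<comment> \<open>Zeros of \<open>G\<close> outside the smaller circle can only increase the
    count.\<close>
  also have "\<dots> \<le> of_int (\<Sum>z | z \<in> unit_disk \<and> G z = 0. zorder G z)"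
    unfolding of_int_le_iff
  proof (rule sum_mono2)
    show "finite {z. z \<in> unit_disk \<and> G z = 0}"
      using circle_winding_disk_algebra(1)[OF Gcont Gholo Gnz] by simp
    fix z assume z: "z \<in> {z. z \<in> unit_disk \<and> G z = 0} - {z. z \<in> ball 0 r \<and> G z = 0}"
    have "complex_of_real r \<in> unit_disk" "G (of_real r) \<noteq> 0" using r01 Gnz_r[of "of_real r"] by auto
    from zorder_zero_pos[OF Gholo this, of z] show "0 \<le> zorder G z" using z by simp
  qed (use r01 in auto)
  also have "\<dots> = circle_winding G"
    using circle_winding_disk_algebra(2)[OF Gcont Gholo Gnz] by simp
  finally have WG: "circle_winding G > real (m + n)" using W_r_gt by linarith
  define h where "h = (\<lambda>t. poly q t + (- w) * t ^ n)"
  have hA: "h \<in> disk_algebra"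
    using disk_algebra_add[OF disk_algebra_poly[of q] disk_algebra_poly[of "monom (- w) n"]]
    unfolding h_def poly_monom .
  have hG: "\<Phi> (cnj t) + h t = t ^ n * G (cnj t)" if "t \<in> unit_circle" for t
    using reflected[OF that, of "- w"] by (simp add: G_def h_def)
  have "\<Phi> (cnj t) + h t \<noteq> 0" if "t \<in> unit_circle" for t
  proof -
    have "t \<noteq> 0" "cnj t \<in> unit_circle" using that by auto
    then show ?thesis using hG[OF that] Gnz[of "cnj t"] by simp
  qed
  then have "- real m \<le> circle_winding (\<lambda>t. \<Phi> (cnj t) + h t)" by (rule wind[OF hA])
  also have "\<dots> = circle_winding (\<lambda>t. t ^ n * G (cnj t))" by (rule circle_winding_cong[OF hG])
  also have "\<dots> = real n - circle_winding G"
    by (rule circle_winding_shift_reflect[OF _ Gnz]) (rule continuous_on_subset[OF Gcont], auto)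
  finally show False using WG by simp
qed

text \<open>Replacing \<open>h\<close> by a close polynomial \<open>q\<close> keeps the winding
  number, which then equals \<open>n\<close> minus the number of zeros of \<open>g\<close>. The
  degree of \<open>q\<close> is not under control, which is why the bound on zeros is asked for
  every \<open>n\<close>.\<close>

lemma winding_ge_of_disk_zeros_le:
  assumes \<Phi>: "\<Phi> \<in> disk_algebra" and h: "h \<in> disk_algebra"
    and nz: "\<And>t. t \<in> unit_circle \<Longrightarrow> \<Phi> (cnj t) + h t \<noteq> 0"
    and zeros: "\<And>n p. degree p \<le> n \<Longrightarrow> disk_zeros (\<lambda>z. z ^ n * \<Phi> z + poly p z) \<le> enat (m + n)"
  shows "circle_winding (\<lambda>t. \<Phi> (cnj t) + h t) \<ge> - real m"
proof -
  have cont: "continuous_on (cball 0 1) f" if "f \<in> disk_algebra" for f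
    using that by (simp add: disk_algebra_def)
  have sumcont: "continuous_on unit_circle (\<lambda>t. \<Phi> (cnj t) + f t)" if "f \<in> disk_algebra" for f
    by (intro continuous_intros continuous_on_compose2[OF cont[OF \<Phi>]] continuous_on_subset[OF cont[OF that]]) auto
  obtain e where e: "e > 0" "\<And>t. t \<in> unit_circle \<Longrightarrow> e \<le> norm (\<Phi> (cnj t) + h t)"
    using norm_bounded_away_from_0[OF compact_sphere sumcont[OF h] nz] by blast
  obtain q where q: "\<And>z. z \<in> cball 0 1 \<Longrightarrow> norm (poly q z - h z) < e"
    using disk_algebra_poly_approx[OF h e(1)] by blast
  have near: "norm ((\<Phi> (cnj t) + poly q t) - (\<Phi> (cnj t) + h t)) < norm (\<Phi> (cnj t) + h t)"
    if "t \<in> unit_circle" for t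
    using q[of t] e(2)[OF that] that by simp
  have eq1: "circle_winding (\<lambda>t. \<Phi> (cnj t) + poly q t) = circle_winding (\<lambda>t. \<Phi> (cnj t) + h t)"
    by (rule circle_winding_nearby[OF sumcont[OF h] sumcont[OF disk_algebra_poly] near])
  define n where "n = degree q"
  obtain p where p: "degree p \<le> n" "\<And>x. x \<noteq> 0 \<Longrightarrow> poly p x = x ^ n * poly q (inverse x)"
    using reversed_poly[of q n] by (auto simp: n_def)
  define g where "g = (\<lambda>z. z ^ n * \<Phi> z + poly p z)"
  have "(\<lambda>z. z ^ n) \<in> disk_algebra"
    using disk_algebra_poly[of "monom 1 n"] by (simp add: poly_monom[abs_def])
  then have gA: "g \<in> disk_algebra"
    unfolding g_def by (intro disk_algebra_add disk_algebra_mult \<Phi> disk_algebra_poly)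
  have reflected: "\<Phi> (cnj t) + poly q t = t ^ n * g (cnj t)" if "t \<in> unit_circle" for t
  proof -
    have t: "norm t = 1" "norm (cnj t) = 1" "cnj t \<noteq> 0" using that by auto
    have "t ^ n * g (cnj t) = (t ^ n * cnj t ^ n) * (\<Phi> (cnj t) + poly q (inverse (cnj t)))"
      unfolding g_def p(2)[OF t(3)] by (simp add: algebra_simps)
    then show ?thesis using t by (simp add: circle_mult_cnj_power circle_inverse)
  qed
  \<comment> \<open>A zero of \<open>g\<close> at \<open>t\<close> is a zero of the approximating
    sum at \<open>cnj t\<close>. There \<open>near\<close> would bound the norm of
    \<open>\<Phi> t + h (cnj t)\<close> strictly by itself.\<close>
  have gnz: "g t \<noteq> 0" if "t \<in> unit_circle" for t
  proof
    assume "g t = 0"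
    then have 0: "\<Phi> (cnj (cnj t)) + poly q (cnj t) = 0" using reflected[of "cnj t"] that by simp
    have "cnj t \<in> unit_circle" using that by simp
    from near[OF this] show False unfolding 0 by (simp only: diff_0 norm_minus_cancel less_irrefl)
  qed
  have gcont: "continuous_on (cball 0 1) g" and gholo: "g holomorphic_on unit_disk"
    using gA by (simp_all add: disk_algebra_def)
  have W: "finite {z \<in> unit_disk. g z = 0}"
    "circle_winding g = of_int (\<Sum>z | z \<in> unit_disk \<and> g z = 0. zorder g z)"
    by (rule circle_winding_disk_algebra[OF gcont gholo gnz]; assumption)+
  have "(\<Sum>z | z \<in> unit_disk \<and> g z = 0. nat (zorder g z)) \<le> m + n"
    using zeros[OF p(1)] W(1) unfolding g_def[symmetric] disk_zeros_def by simp
  moreover have "(\<Sum>z | z \<in> unit_disk \<and> g z = 0. zorder g z) \<le> int (\<Sum>z | z \<in> unit_disk \<and> g z = 0. nat (zorder g z))"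
    unfolding of_nat_sum by (intro sum_mono) simp
  ultimately have "(\<Sum>z | z \<in> unit_disk \<and> g z = 0. zorder g z) \<le> int (m + n)" by linarith
  then have "real_of_int (\<Sum>z | z \<in> unit_disk \<and> g z = 0. zorder g z) \<le> real_of_int (int (m + n))"
    by (simp only: of_int_le_iff)
  then have "circle_winding g \<le> real (m + n)"
    using W(2) by (simp only: of_int_of_nat_eq)
  moreover have "circle_winding (\<lambda>t. \<Phi> (cnj t) + poly q t) = circle_winding (\<lambda>t. t ^ n * g (cnj t))"
    by (rule circle_winding_cong[OF reflected])
  moreover have "\<dots> = real n - circle_winding g"
    by (rule circle_winding_shift_reflect[OF _ gnz]) (rule continuous_on_subset[OF gcont], auto)
  ultimately show ?thesis using eq1 by simp
qed

theorem proposition4: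
  fixes f :: "complex \<Rightarrow> complex" and \<alpha> :: real and m :: nat
  assumes "\<alpha> > 1/2"
    and "holder_on \<alpha> unit_circle f"
    and "\<not> (\<exists>g\<in>disk_algebra. \<forall>t\<in>unit_circle. f t = g t)"
    and "m \<ge> 1"
  shows "(\<forall>h\<in>disk_algebra. (\<forall>t\<in>unit_circle. f t + h t \<noteq> 0) \<longrightarrow>
             circle_winding (\<lambda>t. f t + h t) \<ge> - real m)
     \<longleftrightarrow> (\<forall>n. \<forall>p :: complex poly. degree p \<le> n \<longrightarrow>
             disk_zeros (\<lambda>z. reflected_part f n z + poly p z) \<le> enat (m + n))"
proof -
  obtain \<Psi> \<Phi> \<beta> where \<Psi>: "\<Psi> \<in> disk_algebra" and \<Phi>: "\<Phi> \<in> disk_algebra"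
    and \<beta>: "1/2 < \<beta>" "\<beta> < 1" and hol: "holder_on \<beta> unit_circle \<Phi>"
    and f_eq: "\<And>t. t \<in> unit_circle \<Longrightarrow> f t = \<Psi> t + \<Phi> (cnj t)"
    and \<Phi>_0: "\<Phi> 0 = 0" and \<Phi>_eq: "\<And>z. z \<noteq> 0 \<Longrightarrow> norm z < 1 \<Longrightarrow> anti_analytic_part f (1 / z) = \<Phi> z"
    using holder_decomposition[OF assms(1,2)] by metis
  \<comment> \<open>The explicit value of \<open>reflected_part\<close> at the origin agrees with
    \<open>\<Phi> 0 = 0\<close>, so the two functions coincide on the whole disk.\<close>
  have zeros_eq: "disk_zeros (\<lambda>z. reflected_part f n z + poly p z) = disk_zeros (\<lambda>z. z ^ n * \<Phi> z + poly p z)" for n p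
    by (rule disk_zeros_cong) (auto simp: reflected_part_def \<Phi>_0 \<Phi>_eq)
  have wind_eq: "circle_winding (\<lambda>t. f t + h t) = circle_winding (\<lambda>t. \<Phi> (cnj t) + (\<Psi> t + h t))" for h
    by (rule circle_winding_cong) (simp add: f_eq)
  show ?thesis
    unfolding zeros_eq
  proof (intro iffI ballI allI impI)
    fix n and p :: "complex poly"
    assume wind: "\<forall>h\<in>disk_algebra. (\<forall>t\<in>unit_circle. f t + h t \<noteq> 0) \<longrightarrow>
             circle_winding (\<lambda>t. f t + h t) \<ge> - real m"
      and p: "degree p \<le> n"
    show "disk_zeros (\<lambda>z. z ^ n * \<Phi> z + poly p z) \<le> enat (m + n)"
    proof (rule disk_zeros_le_of_winding_ge[OF \<Phi> \<beta> hol _ _ p])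
      fix h assume h: "h \<in> disk_algebra" and nz: "\<And>t. t \<in> unit_circle \<Longrightarrow> \<Phi> (cnj t) + h t \<noteq> 0"
      \<comment> \<open>The function to be added to \<open>f\<close> is \<open>h\<close> shifted by
        \<open>\<Psi>\<close>, since \<open>f\<close> itself already contains
        \<open>\<Psi>\<close>.\<close>
      have "(\<lambda>t. h t - \<Psi> t) \<in> disk_algebra" by (rule disk_algebra_diff[OF h \<Psi>])
      moreover have "\<forall>t\<in>unit_circle. f t + (h t - \<Psi> t) \<noteq> 0" using nz f_eq by simp
      ultimately have "circle_winding (\<lambda>t. f t + (h t - \<Psi> t)) \<ge> - real m"
        using bspec[OF wind, of "\<lambda>t. h t - \<Psi> t"] by blast
      then show "circle_winding (\<lambda>t. \<Phi> (cnj t) + h t) \<ge> - real m" unfolding wind_eq by simp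
    next
      fix h assume h: "h \<in> disk_algebra"
      have \<Psi>h: "(\<lambda>t. \<Psi> t - h t) \<in> disk_algebra" by (rule disk_algebra_diff[OF \<Psi> h])
      \<comment> \<open>Otherwise \<open>f\<close> would be the restriction of
        \<open>\<Psi> - h\<close>, an element of the disk algebra.\<close>
      have "\<not> (\<forall>t\<in>unit_circle. f t = \<Psi> t - h t)"
        using assms(3) by (rule contrapos_nn) (rule bexI[OF _ \<Psi>h])
      then obtain t where t: "t \<in> unit_circle" "f t \<noteq> \<Psi> t - h t" by blast
      then have "\<Phi> (cnj t) + h t \<noteq> 0" using f_eq[OF t(1)] by (auto simp: add_eq_0_iff)
      then show "\<exists>t\<in>unit_circle. \<Phi> (cnj t) + h t \<noteq> 0" using t(1) by blast
    qed
  next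
    fix h assume zeros: "\<forall>n. \<forall>p :: complex poly. degree p \<le> n \<longrightarrow>
             disk_zeros (\<lambda>z. z ^ n * \<Phi> z + poly p z) \<le> enat (m + n)"
      and h: "h \<in> disk_algebra" and nz: "\<forall>t\<in>unit_circle. f t + h t \<noteq> 0"
    show "circle_winding (\<lambda>t. f t + h t) \<ge> - real m"
      unfolding wind_eq
      by (rule winding_ge_of_disk_zeros_le[OF \<Phi> disk_algebra_add[OF \<Psi> h]])
        (use nz f_eq zeros in \<open>auto simp: ac_simps\<close>)
  qed
qed

end
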